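(* Let $M(c)$ be a $(2n+s)$-dimensional $S$-space-form of constant $f$-sectional curvature $c$. Then $M$ is of constant $\mathcal{L}$-sectional curvature (equal to $c$) with respect to its Riemannian (Levi-Civita) connection if and only if $c=s$.
   Context: A metric $f$-manifold is a $(2n+s)$-dimensional differentiable manifold $M$ ($n,s\geq 1$) with a $(1,1)$ tensor field $f$, vector fields $\xi_1,\dots,\xi_s$ (structure vector fields), 1-forms $\eta^1,\dots,\eta^s$ and a Riemannian metric $g$ such that $f^2=-I+\sum_{\alpha=1}^s\eta^\alpha\otimes\xi_\alpha$, $\eta^\alpha(\xi_\beta)=\delta_{\alpha\beta}$, $f\xi_\alpha=0$, $\eta^\alpha\circ f=0$, $g(fX,fY)=g(X,Y)-\sum_{\alpha=1}^s\eta^\alpha(X)\eta^\alpha(Y)$; moreover $\eta^\alpha(X)=g(X,\xi_\alpha)$ and $g(X,fY)=-g(fX,Y)$. The fundamental 2-form is $\Phi(X,Y)=g(X,fY)$. $M$ is an $S$-manifold if it is normal, i.e. $[f,f]+2\sum_{\alpha=1}^s d\eta^\alpha\otimes\xi_\alpha=0$ with $[f,f](X,Y)=f^2[X,Y]+[fX,fY]-f[fX,Y]-f[X,fY]$, and for every $1\leq\alpha\leq s$: $\eta^1\wedge\cdots\wedge\eta^s\wedge(d\eta^\alpha)^n\neq 0$ everywhere and $\Phi=d\eta^\alpha$. Convention: $d\eta(X,Y)=\frac12\left(X\eta(Y)-Y\eta(X)-\eta([X,Y])\right)$. $\mathcal{L}$ is the distribution orthogonal to the span of $\xi_1,\dots,\xi_s$.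 For the Riemannian connection $\nabla$ with curvature $R(X,Y)Z=\nabla_X\nabla_YZ-\nabla_Y\nabla_XZ-\nabla_{[X,Y]}Z$, put $R(X,Y,Z,W)=g(R(X,Y)Z,W)$ and, for orthonormal $X,Y$, $K(X,Y)=R(X,Y,Y,X)$. The $\mathcal{L}$-sectional curvature is $K_{\mathcal{L}}(X,Y)=K(X,Y)$ for orthonormal $X,Y\in\mathcal{L}$; it is constant equal to $c$ if this value is $c$ at every point and for all orthonormal $X,Y\in\mathcal{L}$. The $f$-sectional curvature is $K(X,fX)$ for unit $X\in\mathcal{L}$. An $S$-space-form $M(c)$ is an $S$-manifold whose $f$-sectional curvature is constant equal to $c$.
   Formalization: The formal theorem assumes n ≥ 2; for n = 1 every orthonormal pair in L is X, ±fX, so the L-sectional curvature is always c and the "only if" fails (e.g. the Heisenberg Sasakian space form with n = s = 1, c = −3). *)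

theory Defs
  imports "HOL-Analysis.Analysis" "HOL-Combinatorics.Permutations"
begin

section \<open>Smooth manifolds\<close>

text \<open>For functions on an open subset of a Euclidean space.\<close>

primrec C_k_on :: "nat \<Rightarrow> 'e::euclidean_space set \<Rightarrow> ('e \<Rightarrow> 'b::real_normed_vector) \<Rightarrow> bool" where
  "C_k_on 0 S h \<longleftrightarrow> continuous_on S h"
| "C_k_on (Suc k) S h \<longleftrightarrow>
     (\<forall>x\<in>S. h differentiable (at x)) \<and>
     (\<forall>v. C_k_on k S (\<lambda>x. frechet_derivative h (at x) v))"

definition C_infinity_on :: "'e::euclidean_space set \<Rightarrow> ('e \<Rightarrow> 'b::real_normed_vector) \<Rightarrow> bool" where
  "C_infinity_on S h \<longleftrightarrow> (\<forall>k. C_k_on k S h)"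

text \<open>
  The manifold is the whole type \<open>'m\<close>, Hausdorff and second countable by its sort; it is
  automatically nonempty.  A chart is a pair of its domain and its coordinate map, whose values
  outside the domain are irrelevant.  The atlas need not be maximal.
\<close>

type_synonym ('m, 'e) atlas = "('m set \<times> ('m \<Rightarrow> 'e)) set"

definition smooth_atlas ::
  "('m::{t2_space,second_countable_topology}, 'e::euclidean_space) atlas \<Rightarrow> bool" where
  "smooth_atlas A \<longleftrightarrow>
     (\<Union>(U, \<phi>)\<in>A. U) = UNIV \<and>
     (\<forall>(U, \<phi>)\<in>A. open U \<and> open (\<phi> ` U) \<and> homeomorphism U (\<phi> ` U) \<phi> (inv_into U \<phi>)) \<and>
     (\<forall>(U, \<phi>)\<in>A. \<forall>(V, \<psi>)\<in>A. C_infinity_on (\<phi> ` (U \<inter> V)) (\<psi> \<circ> inv_into U \<phi>))"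

definition smooth_fun :: "('m, 'e::euclidean_space) atlas \<Rightarrow> ('m \<Rightarrow> real) \<Rightarrow> bool" where
  "smooth_fun A h \<longleftrightarrow> (\<forall>(U, \<phi>)\<in>A. C_infinity_on (\<phi> ` U) (h \<circ> inv_into U \<phi>))"

text \<open>
  Tangent vectors at \<open>p\<close> are the derivations at \<open>p\<close> of the algebra of smooth functions, with
  value \<open>0\<close> on non-smooth functions so that equality of tangent vectors is equality in HOL.
  Linear combinations are formed pointwise, and \<open>\<lambda>_. 0\<close> is the zero vector.
\<close>

type_synonym 'm tvec = "('m \<Rightarrow> real) \<Rightarrow> real"

definition tangent_space :: "('m, 'e::euclidean_space) atlas \<Rightarrow> 'm \<Rightarrow> 'm tvec set" where
  "tangent_space A p = {v.
     (\<forall>h k a b. smooth_fun A h \<longrightarrow> smooth_fun A k \<longrightarrow>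
        v (\<lambda>q. a * h q + b * k q) = a * v h + b * v k) \<and>
     (\<forall>h k. smooth_fun A h \<longrightarrow> smooth_fun A k \<longrightarrow>
        v (\<lambda>q. h q * k q) = h p * v k + k p * v h) \<and>
     (\<forall>h. \<not> smooth_fun A h \<longrightarrow> v h = 0)}"

text \<open>Smooth vector fields; \<open>X p h\<close> is the derivative of \<open>h\<close> at \<open>p\<close> along \<open>X\<close>.\<close>

type_synonym 'm vfield = "'m \<Rightarrow> 'm tvec"

definition vector_field :: "('m, 'e::euclidean_space) atlas \<Rightarrow> 'm vfield \<Rightarrow> bool" where
  "vector_field A X \<longleftrightarrow>
     (\<forall>p. X p \<in> tangent_space A p) \<and>
     (\<forall>h. smooth_fun A h \<longrightarrow> smooth_fun A (\<lambda>p. X p h))"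

definition lie_bracket :: "'m vfield \<Rightarrow> 'm vfield \<Rightarrow> 'm vfield" where
  "lie_bracket X Y = (\<lambda>p h. X p (\<lambda>q. Y q h) - Y p (\<lambda>q. X q h))"

section \<open>Tensor fields\<close>

text \<open>
  Tensor fields are families of multilinear maps on the tangent spaces.  Smoothness is expressed
  by evaluation on smooth vector fields.
\<close>

definition one_form :: "('m, 'e::euclidean_space) atlas \<Rightarrow> ('m \<Rightarrow> 'm tvec \<Rightarrow> real) \<Rightarrow> bool" where
  "one_form A \<eta> \<longleftrightarrow>
     (\<forall>p. \<forall>v\<in>tangent_space A p. \<forall>w\<in>tangent_space A p. \<forall>a b.
        \<eta> p (\<lambda>h. a * v h + b * w h) = a * \<eta> p v + b * \<eta> p w) \<and>
     (\<forall>X. vector_field A X \<longrightarrow> smooth_fun A (\<lambda>p. \<eta> p (X p)))"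

definition tensor_field_1_1 ::
  "('m, 'e::euclidean_space) atlas \<Rightarrow> ('m \<Rightarrow> 'm tvec \<Rightarrow> 'm tvec) \<Rightarrow> bool" where
  "tensor_field_1_1 A f \<longleftrightarrow>
     (\<forall>p. \<forall>v\<in>tangent_space A p. f p v \<in> tangent_space A p) \<and>
     (\<forall>p. \<forall>v\<in>tangent_space A p. \<forall>w\<in>tangent_space A p. \<forall>a b.
        f p (\<lambda>h. a * v h + b * w h) = (\<lambda>h. a * f p v h + b * f p w h)) \<and>
     (\<forall>X. vector_field A X \<longrightarrow> vector_field A (\<lambda>p. f p (X p)))"

definition riemannian_metric ::
  "('m, 'e::euclidean_space) atlas \<Rightarrow> ('m \<Rightarrow> 'm tvec \<Rightarrow> 'm tvec \<Rightarrow> real) \<Rightarrow> bool" where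
  "riemannian_metric A g \<longleftrightarrow>
     (\<forall>p. \<forall>u\<in>tangent_space A p. \<forall>v\<in>tangent_space A p. \<forall>w\<in>tangent_space A p. \<forall>a b.
        g p (\<lambda>h. a * u h + b * v h) w = a * g p u w + b * g p v w) \<and>
     (\<forall>p. \<forall>v\<in>tangent_space A p. \<forall>w\<in>tangent_space A p. g p v w = g p w v) \<and>
     (\<forall>p. \<forall>v\<in>tangent_space A p. v \<noteq> (\<lambda>_. 0) \<longrightarrow> g p v v > 0) \<and>
     (\<forall>X Y. vector_field A X \<longrightarrow> vector_field A Y \<longrightarrow> smooth_fun A (\<lambda>p. g p (X p) (Y p)))"

text \<open>Exterior derivative of a 1-form, with the factor \<open>1/2\<close>.\<close>

definition ext_deriv :: "('m \<Rightarrow> 'm tvec \<Rightarrow> real) \<Rightarrow> 'm vfield \<Rightarrow> 'm vfield \<Rightarrow> 'm \<Rightarrow> real" where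
  "ext_deriv \<eta> X Y p =
     (X p (\<lambda>q. \<eta> q (Y q)) - Y p (\<lambda>q. \<eta> q (X q)) - \<eta> p (lie_bracket X Y p)) / 2"

text \<open>
  A \<open>k\<close>-form (at a point) is represented as a function of a sequence of arguments depending only
  on those with index below \<open>k\<close>.  The normalization \<open>1/(k+l)!\<close> of the wedge product
  is the one that goes with the factor \<open>1/2\<close> in \<^const>\<open>ext_deriv\<close>.
\<close>

definition wedge ::
  "nat \<Rightarrow> nat \<Rightarrow> ((nat \<Rightarrow> 'v) \<Rightarrow> real) \<Rightarrow> ((nat \<Rightarrow> 'v) \<Rightarrow> real) \<Rightarrow> (nat \<Rightarrow> 'v) \<Rightarrow> real" where
  "wedge k l \<omega> \<theta> x =
     (\<Sum>\<sigma> | \<sigma> permutes {..<k + l}.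
        of_int (sign \<sigma>) * \<omega> (\<lambda>i. x (\<sigma> i)) * \<theta> (\<lambda>i. x (\<sigma> (k + i)))) / fact (k + l)"

text \<open>\<open>wedge_upto d \<Omega> m\<close> is \<open>\<Omega> 1 \<and> \<dots> \<and> \<Omega> m\<close> for forms \<open>\<Omega> 1, \<dots>, \<Omega> m\<close> of degree \<open>d\<close>.\<close>

primrec wedge_upto ::
  "nat \<Rightarrow> (nat \<Rightarrow> (nat \<Rightarrow> 'v) \<Rightarrow> real) \<Rightarrow> nat \<Rightarrow> (nat \<Rightarrow> 'v) \<Rightarrow> real" where
  "wedge_upto d \<Omega> 0 = (\<lambda>_. 1)"
| "wedge_upto d \<Omega> (Suc m) = wedge (m * d) d (wedge_upto d \<Omega> m) (\<Omega> (Suc m))"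

section \<open>Connections and curvature\<close>

definition affine_connection ::
  "('m, 'e::euclidean_space) atlas \<Rightarrow> ('m vfield \<Rightarrow> 'm vfield \<Rightarrow> 'm vfield) \<Rightarrow> bool" where
  "affine_connection A D \<longleftrightarrow>
     (\<forall>X Y. vector_field A X \<longrightarrow> vector_field A Y \<longrightarrow> vector_field A (D X Y)) \<and>
     (\<forall>X Y Z h k. vector_field A X \<longrightarrow> vector_field A Y \<longrightarrow> vector_field A Z \<longrightarrow>
        smooth_fun A h \<longrightarrow> smooth_fun A k \<longrightarrow>
        D (\<lambda>p j. h p * X p j + k p * Y p j) Z = (\<lambda>p j. h p * D X Z p j + k p * D Y Z p j)) \<and>
     (\<forall>X Y Z. vector_field A X \<longrightarrow> vector_field A Y \<longrightarrow> vector_field A Z \<longrightarrow>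
        D X (\<lambda>p j. Y p j + Z p j) = (\<lambda>p j. D X Y p j + D X Z p j)) \<and>
     (\<forall>X Y h. vector_field A X \<longrightarrow> vector_field A Y \<longrightarrow> smooth_fun A h \<longrightarrow>
        D X (\<lambda>p j. h p * Y p j) = (\<lambda>p j. X p h * Y p j + h p * D X Y p j))"

definition riemannian_connection ::
  "('m, 'e::euclidean_space) atlas \<Rightarrow> ('m \<Rightarrow> 'm tvec \<Rightarrow> 'm tvec \<Rightarrow> real) \<Rightarrow>
   ('m vfield \<Rightarrow> 'm vfield \<Rightarrow> 'm vfield) \<Rightarrow> bool" where
  "riemannian_connection A g D \<longleftrightarrow>
     affine_connection A D \<and>
     (\<forall>X Y. vector_field A X \<longrightarrow> vector_field A Y \<longrightarrow>
        (\<lambda>p h. D X Y p h - D Y X p h) = lie_bracket X Y) \<and>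
     (\<forall>X Y Z p. vector_field A X \<longrightarrow> vector_field A Y \<longrightarrow> vector_field A Z \<longrightarrow>
        X p (\<lambda>q. g q (Y q) (Z q)) = g p (D X Y p) (Z p) + g p (Y p) (D X Z p))"

definition curvature ::
  "('m vfield \<Rightarrow> 'm vfield \<Rightarrow> 'm vfield) \<Rightarrow> 'm vfield \<Rightarrow> 'm vfield \<Rightarrow> 'm vfield \<Rightarrow> 'm vfield" where
  "curvature D X Y Z =
     (\<lambda>p h. D X (D Y Z) p h - D Y (D X Z) p h - D (lie_bracket X Y) Z p h)"

definition curvature4 ::
  "('m \<Rightarrow> 'm tvec \<Rightarrow> 'm tvec \<Rightarrow> real) \<Rightarrow> ('m vfield \<Rightarrow> 'm vfield \<Rightarrow> 'm vfield) \<Rightarrow>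
   'm vfield \<Rightarrow> 'm vfield \<Rightarrow> 'm vfield \<Rightarrow> 'm vfield \<Rightarrow> 'm \<Rightarrow> real" where
  "curvature4 g D X Y Z W p = g p (curvature D X Y Z p) (W p)"

text \<open>
  The curvature is tensorial and every tangent vector at \<open>p\<close> is the value at \<open>p\<close> of a smooth
  vector field on \<open>M\<close>.  Hence statements about the sectional curvature of tangent vectors at
  \<open>p\<close> are expressed through vector fields having the required property at the point \<open>p\<close>.
\<close>

definition sectional_curvature ::
  "('m \<Rightarrow> 'm tvec \<Rightarrow> 'm tvec \<Rightarrow> real) \<Rightarrow> ('m vfield \<Rightarrow> 'm vfield \<Rightarrow> 'm vfield) \<Rightarrow>
   'm vfield \<Rightarrow> 'm vfield \<Rightarrow> 'm \<Rightarrow> real" where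
  "sectional_curvature g D X Y p = curvature4 g D X Y Y X p"

section \<open>Metric f-manifolds and S-manifolds\<close>

text \<open>The indices \<open>\<alpha>\<close> of \<open>\<xi>\<close> and \<open>\<eta>\<close> range over \<open>{1..s}\<close>.\<close>

definition metric_f_manifold ::
  "nat \<Rightarrow> nat \<Rightarrow> ('m::{t2_space,second_countable_topology}, 'e::euclidean_space) atlas \<Rightarrow>
   ('m \<Rightarrow> 'm tvec \<Rightarrow> 'm tvec) \<Rightarrow> (nat \<Rightarrow> 'm vfield) \<Rightarrow> (nat \<Rightarrow> 'm \<Rightarrow> 'm tvec \<Rightarrow> real) \<Rightarrow>
   ('m \<Rightarrow> 'm tvec \<Rightarrow> 'm tvec \<Rightarrow> real) \<Rightarrow> bool" where
  "metric_f_manifold n s A f \<xi> \<eta> g \<longleftrightarrow>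
     1 \<le> n \<and> 1 \<le> s \<and> DIM('e) = 2 * n + s \<and> smooth_atlas A \<and>
     tensor_field_1_1 A f \<and> (\<forall>\<alpha>\<in>{1..s}. vector_field A (\<xi> \<alpha>) \<and> one_form A (\<eta> \<alpha>)) \<and>
     riemannian_metric A g \<and>
     (\<forall>p. \<forall>v\<in>tangent_space A p.
        f p (f p v) = (\<lambda>h. - v h + (\<Sum>\<alpha>=1..s. \<eta> \<alpha> p v * \<xi> \<alpha> p h))) \<and>
     (\<forall>p. \<forall>\<alpha>\<in>{1..s}. \<forall>\<beta>\<in>{1..s}. \<eta> \<alpha> p (\<xi> \<beta> p) = (if \<alpha> = \<beta> then 1 else 0)) \<and>
     (\<forall>p. \<forall>\<alpha>\<in>{1..s}. f p (\<xi> \<alpha> p) = (\<lambda>_. 0)) \<and>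
     (\<forall>p. \<forall>\<alpha>\<in>{1..s}. \<forall>v\<in>tangent_space A p. \<eta> \<alpha> p (f p v) = 0) \<and>
     (\<forall>p. \<forall>v\<in>tangent_space A p. \<forall>w\<in>tangent_space A p.
        g p (f p v) (f p w) = g p v w - (\<Sum>\<alpha>=1..s. \<eta> \<alpha> p v * \<eta> \<alpha> p w)) \<and>
     (\<forall>p. \<forall>\<alpha>\<in>{1..s}. \<forall>v\<in>tangent_space A p. \<eta> \<alpha> p v = g p v (\<xi> \<alpha> p)) \<and>
     (\<forall>p. \<forall>v\<in>tangent_space A p. \<forall>w\<in>tangent_space A p. g p v (f p w) = - g p (f p v) w)"

definition fundamental_form ::
  "('m \<Rightarrow> 'm tvec \<Rightarrow> 'm tvec) \<Rightarrow> ('m \<Rightarrow> 'm tvec \<Rightarrow> 'm tvec \<Rightarrow> real) \<Rightarrow>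
   'm vfield \<Rightarrow> 'm vfield \<Rightarrow> 'm \<Rightarrow> real" where
  "fundamental_form f g X Y p = g p (X p) (f p (Y p))"

definition app_field :: "('m \<Rightarrow> 'm tvec \<Rightarrow> 'm tvec) \<Rightarrow> 'm vfield \<Rightarrow> 'm vfield" where
  "app_field f X = (\<lambda>p. f p (X p))"

definition nijenhuis :: "('m \<Rightarrow> 'm tvec \<Rightarrow> 'm tvec) \<Rightarrow> 'm vfield \<Rightarrow> 'm vfield \<Rightarrow> 'm vfield" where
  "nijenhuis f X Y = (\<lambda>p h.
     app_field f (app_field f (lie_bracket X Y)) p h
     + lie_bracket (app_field f X) (app_field f Y) p h
     - app_field f (lie_bracket (app_field f X) Y) p h
     - app_field f (lie_bracket X (app_field f Y)) p h)"

definition normal_structure ::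
  "nat \<Rightarrow> ('m, 'e::euclidean_space) atlas \<Rightarrow>
   ('m \<Rightarrow> 'm tvec \<Rightarrow> 'm tvec) \<Rightarrow> (nat \<Rightarrow> 'm vfield) \<Rightarrow> (nat \<Rightarrow> 'm \<Rightarrow> 'm tvec \<Rightarrow> real) \<Rightarrow> bool" where
  "normal_structure s A f \<xi> \<eta> \<longleftrightarrow>
     (\<forall>X Y p h. vector_field A X \<longrightarrow> vector_field A Y \<longrightarrow>
        nijenhuis f X Y p h + 2 * (\<Sum>\<alpha>=1..s. ext_deriv (\<eta> \<alpha>) X Y p * \<xi> \<alpha> p h) = 0)"

text \<open>
  The value at \<open>p\<close> of the top-degree form \<open>\<eta> 1 \<and> \<dots> \<and> \<eta> s \<and> (d(\<eta> \<alpha>))^n\<close>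
  on the vector fields \<open>X 0, \<dots>, X (2 * n + s - 1)\<close>.
\<close>

definition eta_volume_form ::
  "nat \<Rightarrow> nat \<Rightarrow> (nat \<Rightarrow> 'm \<Rightarrow> 'm tvec \<Rightarrow> real) \<Rightarrow> nat \<Rightarrow> 'm \<Rightarrow> (nat \<Rightarrow> 'm vfield) \<Rightarrow> real" where
  "eta_volume_form n s \<eta> \<alpha> p =
     wedge s (2 * n)
       (wedge_upto 1 (\<lambda>\<beta> X. \<eta> \<beta> p (X 0 p)) s)
       (wedge_upto 2 (\<lambda>_ X. ext_deriv (\<eta> \<alpha>) (X 0) (X 1) p) n)"

definition S_manifold ::
  "nat \<Rightarrow> nat \<Rightarrow> ('m::{t2_space,second_countable_topology}, 'e::euclidean_space) atlas \<Rightarrow>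
   ('m \<Rightarrow> 'm tvec \<Rightarrow> 'm tvec) \<Rightarrow> (nat \<Rightarrow> 'm vfield) \<Rightarrow> (nat \<Rightarrow> 'm \<Rightarrow> 'm tvec \<Rightarrow> real) \<Rightarrow>
   ('m \<Rightarrow> 'm tvec \<Rightarrow> 'm tvec \<Rightarrow> real) \<Rightarrow> bool" where
  "S_manifold n s A f \<xi> \<eta> g \<longleftrightarrow>
     metric_f_manifold n s A f \<xi> \<eta> g \<and>
     normal_structure s A f \<xi> \<eta> \<and>
     (\<forall>\<alpha>\<in>{1..s}.
        (\<forall>p. \<exists>X. (\<forall>i<2 * n + s. vector_field A (X i)) \<and> eta_volume_form n s \<eta> \<alpha> p X \<noteq> 0) \<and>
        (\<forall>X Y. vector_field A X \<longrightarrow> vector_field A Y \<longrightarrow>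
           fundamental_form f g X Y = ext_deriv (\<eta> \<alpha>) X Y))"

section \<open>Curvature of the distribution orthogonal to the structure vector fields\<close>

definition L_space ::
  "nat \<Rightarrow> ('m, 'e::euclidean_space) atlas \<Rightarrow> (nat \<Rightarrow> 'm vfield) \<Rightarrow>
   ('m \<Rightarrow> 'm tvec \<Rightarrow> 'm tvec \<Rightarrow> real) \<Rightarrow> 'm \<Rightarrow> 'm tvec set" where
  "L_space s A \<xi> g p = {v \<in> tangent_space A p. \<forall>\<alpha>\<in>{1..s}. g p v (\<xi> \<alpha> p) = 0}"

definition constant_L_sectional_curvature ::
  "nat \<Rightarrow> ('m, 'e::euclidean_space) atlas \<Rightarrow> (nat \<Rightarrow> 'm vfield) \<Rightarrow>
   ('m \<Rightarrow> 'm tvec \<Rightarrow> 'm tvec \<Rightarrow> real) \<Rightarrow> ('m vfield \<Rightarrow> 'm vfield \<Rightarrow> 'm vfield) \<Rightarrow> real \<Rightarrow> bool" where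
  "constant_L_sectional_curvature s A \<xi> g D c \<longleftrightarrow>
     (\<forall>p X Y. vector_field A X \<longrightarrow> vector_field A Y \<longrightarrow>
        X p \<in> L_space s A \<xi> g p \<longrightarrow> Y p \<in> L_space s A \<xi> g p \<longrightarrow>
        g p (X p) (X p) = 1 \<longrightarrow> g p (Y p) (Y p) = 1 \<longrightarrow> g p (X p) (Y p) = 0 \<longrightarrow>
        sectional_curvature g D X Y p = c)"

definition constant_f_sectional_curvature ::
  "nat \<Rightarrow> ('m, 'e::euclidean_space) atlas \<Rightarrow> ('m \<Rightarrow> 'm tvec \<Rightarrow> 'm tvec) \<Rightarrow> (nat \<Rightarrow> 'm vfield) \<Rightarrow>
   ('m \<Rightarrow> 'm tvec \<Rightarrow> 'm tvec \<Rightarrow> real) \<Rightarrow> ('m vfield \<Rightarrow> 'm vfield \<Rightarrow> 'm vfield) \<Rightarrow> real \<Rightarrow> bool" where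
  "constant_f_sectional_curvature s A f \<xi> g D c \<longleftrightarrow>
     (\<forall>p X. vector_field A X \<longrightarrow> X p \<in> L_space s A \<xi> g p \<longrightarrow> g p (X p) (X p) = 1 \<longrightarrow>
        sectional_curvature g D X (app_field f X) p = c)"

text \<open>\<open>D\<close> is the Riemannian connection of \<open>g\<close>, which is unique.\<close>

definition S_space_form ::
  "nat \<Rightarrow> nat \<Rightarrow> ('m::{t2_space,second_countable_topology}, 'e::euclidean_space) atlas \<Rightarrow>
   ('m \<Rightarrow> 'm tvec \<Rightarrow> 'm tvec) \<Rightarrow> (nat \<Rightarrow> 'm vfield) \<Rightarrow> (nat \<Rightarrow> 'm \<Rightarrow> 'm tvec \<Rightarrow> real) \<Rightarrow>
   ('m \<Rightarrow> 'm tvec \<Rightarrow> 'm tvec \<Rightarrow> real) \<Rightarrow> ('m vfield \<Rightarrow> 'm vfield \<Rightarrow> 'm vfield) \<Rightarrow> real \<Rightarrow> bool" where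
  "S_space_form n s A f \<xi> \<eta> g D c \<longleftrightarrow>
     S_manifold n s A f \<xi> \<eta> g \<and> riemannian_connection A g D \<and>
     constant_f_sectional_curvature s A f \<xi> g D c"

end

theory Submission
  imports Defs
begin

text \<open>
  Closedness of \<open>\<Phi>\<close> and normality give \<open>\<nabla>\<^sub>X \<xi>\<^sub>\<alpha> = - f X\<close> and, for horizontal
  \<open>X, Y\<close> (that is, orthogonal to all \<open>\<xi>\<^sub>\<alpha>\<close>),
  \<open>(\<nabla>\<^sub>X f)Y = g(X, Y) \<Sum>\<^sub>\<alpha> \<xi>\<^sub>\<alpha>\<close>.  The resulting formula for the commutator of
  \<open>R(X, Y)\<close> and \<open>f\<close> says that \<open>R\<close> minus the curvature tensor of constant curvature \<open>s\<close> has,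
  on horizontal fields, the symmetries of a Kaehler curvature tensor; its holomorphic sectional
  curvature is \<open>c - s\<close>.  Polarization yields, for orthonormal horizontal \<open>X, Y\<close>,
  \<open>K(X, Y) = s + (c - s)/4 * (1 + 3 g(X, f Y)\<^sup>2)\<close>.  This equals \<open>c\<close> if \<open>c = s\<close>, and
  conversely a pair with \<open>g(X, f Y) = 0\<close> forces \<open>c = s\<close>; such a pair exists because \<open>n \<ge> 2\<close>.

  Only global vector fields are used.  No extension of tangent vectors to fields is needed: that
  there are enough fields follows from the nonvanishing of the volume form.
\<close>

section \<open>Smooth functions and vector fields\<close>

lemma frechet_derivative_cong_open:
  assumes "open S" "x \<in> S" "\<And>y. y \<in> S \<Longrightarrow> h y = k y"
  shows "frechet_derivative h (at x) = frechet_derivative k (at x)"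
proof -
  have "(h has_derivative D) (at x) \<longleftrightarrow> (k has_derivative D) (at x)" for D
    using assms has_derivative_transform_within_open[of h D x UNIV S k]
      has_derivative_transform_within_open[of k D x UNIV S h]
    by auto
  then show ?thesis by (simp add: frechet_derivative_def)
qed

lemma differentiable_cong_open:
  assumes "open S" "x \<in> S" "\<And>y. y \<in> S \<Longrightarrow> h y = k y"
  shows "h differentiable (at x) \<longleftrightarrow> k differentiable (at x)"
proof -
  have "(h has_derivative D) (at x) \<longleftrightarrow> (k has_derivative D) (at x)" for D
    using assms has_derivative_transform_within_open[of h D x UNIV S k]
      has_derivative_transform_within_open[of k D x UNIV S h]
    by auto
  then show ?thesis by (simp add: differentiable_def)
qed

text \<open>The formulas for derivatives of sums and products are available only at points of
  \<open>S\<close>. As \<open>S\<close> is open, derivatives there depend only on values in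
  \<open>S\<close>, so such formulas may be substituted under \<open>C_k_on\<close>.\<close>

lemma C_k_on_cong:
  assumes "open S" "\<And>y. y \<in> S \<Longrightarrow> h y = k y"
  shows "C_k_on n S h \<longleftrightarrow> C_k_on n S k"
  using assms(2)
proof (induction n arbitrary: h k)
  case 0
  then show ?case by (simp cong: continuous_on_cong)
next
  case (Suc n)
  have "C_k_on n S (\<lambda>x. frechet_derivative h (at x) v) = C_k_on n S (\<lambda>x. frechet_derivative k (at x) v)" for v
    using frechet_derivative_cong_open[OF assms(1) _ Suc.prems] by (intro Suc.IH) auto
  moreover have "h differentiable (at x) \<longleftrightarrow> k differentiable (at x)" if "x \<in> S" for x
    using differentiable_cong_open[OF assms(1) that Suc.prems] by simp
  ultimately show ?case by auto
qed

text \<open>Serves the product rule: the derivative of a product still contains the undifferentiated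
  factors, which the induction wants one class lower.\<close>

lemma C_k_on_Suc_imp: "C_k_on (Suc n) S h \<Longrightarrow> C_k_on n S h"
proof (induction n arbitrary: h)
  case 0
  then show ?case
    by (auto intro!: differentiable_imp_continuous_on differentiable_at_imp_differentiable_on)
next
  case (Suc n)
  then show ?case by simp
qed

lemma C_k_on_const: "C_k_on n S (\<lambda>_. c)"
  by (induction n arbitrary: c) auto

lemma C_k_on_add:
  assumes "open S" "C_k_on n S h" "C_k_on n S k"
  shows "C_k_on n S (\<lambda>x. h x + k x)"
  using assms(2,3)
proof (induction n arbitrary: h k)
  case 0
  then show ?case by (auto intro: continuous_intros)
next
  case (Suc n)
  have "frechet_derivative (\<lambda>x. h x + k x) (at x) v =
      frechet_derivative h (at x) v + frechet_derivative k (at x) v" if "x \<in> S" for x v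
  proof -
    have "(h has_derivative frechet_derivative h (at x)) (at x)"
      "(k has_derivative frechet_derivative k (at x)) (at x)"
      using Suc.prems that by (auto simp: frechet_derivative_works[symmetric])
    then have "((\<lambda>x. h x + k x) has_derivative
      (\<lambda>v. frechet_derivative h (at x) v + frechet_derivative k (at x) v)) (at x)"
      by (rule has_derivative_add)
    from frechet_derivative_at[OF this] show ?thesis by (simp add: fun_eq_iff)
  qed
  moreover have "C_k_on n S (\<lambda>x. frechet_derivative h (at x) v + frechet_derivative k (at x) v)" for v
    using Suc.prems by (intro Suc.IH) auto
  ultimately have "C_k_on n S (\<lambda>x. frechet_derivative (\<lambda>x. h x + k x) (at x) v)" for v
    by (subst C_k_on_cong[OF assms(1)]) auto
  then show ?case using Suc.prems by auto
qed

lemma C_k_on_mult: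
  fixes h k :: "'e::euclidean_space \<Rightarrow> real"
  assumes "open S" "C_k_on n S h" "C_k_on n S k"
  shows "C_k_on n S (\<lambda>x. h x * k x)"
  using assms(2,3)
proof (induction n arbitrary: h k)
  case 0
  then show ?case by (auto intro: continuous_intros)
next
  case (Suc n)
  have eq: "frechet_derivative (\<lambda>x. h x * k x) (at x) v =
      h x * frechet_derivative k (at x) v + frechet_derivative h (at x) v * k x" if "x \<in> S" for x v
  proof -
    have "(h has_derivative frechet_derivative h (at x)) (at x)"
      "(k has_derivative frechet_derivative k (at x)) (at x)"
      using Suc.prems that by (auto simp: frechet_derivative_works[symmetric])
    then have "((\<lambda>x. h x * k x) has_derivative
      (\<lambda>v. h x * frechet_derivative k (at x) v + frechet_derivative h (at x) v * k x)) (at x)"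
      by (rule has_derivative_mult)
    from frechet_derivative_at[OF this] show ?thesis by (simp add: fun_eq_iff)
  qed
  have "C_k_on n S (\<lambda>x. h x * frechet_derivative k (at x) v + frechet_derivative h (at x) v * k x)" for v
    using Suc.prems C_k_on_Suc_imp[OF Suc.prems(1)] C_k_on_Suc_imp[OF Suc.prems(2)]
    by (intro C_k_on_add[OF assms(1)] Suc.IH) simp_all
  then have "C_k_on n S (\<lambda>x. frechet_derivative (\<lambda>x. h x * k x) (at x) v)" for v
    by (subst C_k_on_cong[OF assms(1) eq])
  then show ?case using Suc.prems by auto
qed

section \<open>The algebra of smooth functions on the manifold\<close>

lemma smooth_fun_const: "smooth_fun A (\<lambda>_. c)"
  by (auto simp: smooth_fun_def C_infinity_on_def o_def C_k_on_const)

lemma smooth_atlas_open: "smooth_atlas A \<Longrightarrow> (U, \<phi>) \<in> A \<Longrightarrow> open (\<phi> ` U)"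
  unfolding smooth_atlas_def by blast

lemma smooth_fun_add:
  assumes "smooth_atlas A" "smooth_fun A h" "smooth_fun A k"
  shows "smooth_fun A (\<lambda>q. h q + k q)"
  unfolding smooth_fun_def C_infinity_on_def o_def
proof clarify
  fix U \<phi> n assume U: "(U, \<phi>) \<in> A"
  then have "C_k_on n (\<phi> ` U) (\<lambda>x. h (inv_into U \<phi> x))" "C_k_on n (\<phi> ` U) (\<lambda>x. k (inv_into U \<phi> x))"
    using assms(2,3) unfolding smooth_fun_def C_infinity_on_def o_def by auto
  then show "C_k_on n (\<phi> ` U) (\<lambda>x. h (inv_into U \<phi> x) + k (inv_into U \<phi> x))"
    by (rule C_k_on_add[OF smooth_atlas_open[OF assms(1) U]])
qed

lemma smooth_fun_mult:
  assumes "smooth_atlas A" "smooth_fun A h" "smooth_fun A k"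
  shows "smooth_fun A (\<lambda>q. h q * k q)"
  unfolding smooth_fun_def C_infinity_on_def o_def
proof clarify
  fix U \<phi> n assume U: "(U, \<phi>) \<in> A"
  then have "C_k_on n (\<phi> ` U) (\<lambda>x. h (inv_into U \<phi> x))" "C_k_on n (\<phi> ` U) (\<lambda>x. k (inv_into U \<phi> x))"
    using assms(2,3) unfolding smooth_fun_def C_infinity_on_def o_def by auto
  then show "C_k_on n (\<phi> ` U) (\<lambda>x. h (inv_into U \<phi> x) * k (inv_into U \<phi> x))"
    by (rule C_k_on_mult[OF smooth_atlas_open[OF assms(1) U]])
qed

lemma smooth_fun_lincomb:
  assumes "smooth_atlas A" "smooth_fun A h" "smooth_fun A k"
  shows "smooth_fun A (\<lambda>q. a * h q + b * k q)"
  using assms by (intro smooth_fun_add smooth_fun_mult smooth_fun_const)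

section \<open>Tangent vectors as derivations, and smooth vector fields\<close>

lemma tangent_lincomb:
  assumes "v \<in> tangent_space A p" "smooth_fun A h" "smooth_fun A k"
  shows "v (\<lambda>q. a * h q + b * k q) = a * v h + b * v k"
  using assms unfolding tangent_space_def by blast

lemma tangent_mult:
  assumes "v \<in> tangent_space A p" "smooth_fun A h" "smooth_fun A k"
  shows "v (\<lambda>q. h q * k q) = h p * v k + k p * v h"
  using assms unfolding tangent_space_def by blast

lemma tangent_not_smooth: "v \<in> tangent_space A p \<Longrightarrow> \<not> smooth_fun A h \<Longrightarrow> v h = 0"
  unfolding tangent_space_def by blast

text \<open>The Leibniz rule for 1 = 1 * 1 gives v(1) = 2 v(1).\<close>

lemma tangent_const:
  assumes "v \<in> tangent_space A p"
  shows "v (\<lambda>q. c) = 0"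
proof -
  have "v (\<lambda>q. 1) = 0"
    using tangent_mult[OF assms smooth_fun_const[where c=1] smooth_fun_const[where c=1]] by simp
  then show ?thesis
    using tangent_lincomb[OF assms smooth_fun_const[where c=1] smooth_fun_const[where c=1], of c 0] by simp
qed

lemma vector_field_tangent: "vector_field A X \<Longrightarrow> X p \<in> tangent_space A p"
  unfolding vector_field_def by blast

lemma vector_field_smooth: "vector_field A X \<Longrightarrow> smooth_fun A h \<Longrightarrow> smooth_fun A (\<lambda>p. X p h)"
  unfolding vector_field_def by blast

lemma tangent_space_lincomb:
  assumes "smooth_atlas A" "v \<in> tangent_space A p" "w \<in> tangent_space A p"
  shows "(\<lambda>h. a * v h + b * w h) \<in> tangent_space A p"
  unfolding tangent_space_def
  by (auto simp: tangent_lincomb[OF assms(2)] tangent_lincomb[OF assms(3)] tangent_mult[OF assms(2)]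
      tangent_mult[OF assms(3)] tangent_not_smooth[OF assms(2)] tangent_not_smooth[OF assms(3)]
      algebra_simps)

lemma vector_field_lincomb:
  assumes "smooth_atlas A" "vector_field A X" "vector_field A Y"
  shows "vector_field A (\<lambda>p h. a * X p h + b * Y p h)"
  using assms unfolding vector_field_def
  by (auto intro: tangent_space_lincomb smooth_fun_lincomb)

lemma vector_field_zero: "vector_field A (\<lambda>p h. 0)"
  unfolding vector_field_def tangent_space_def by (auto intro: smooth_fun_const)

lemma vector_field_lie_bracket:
  assumes A: "smooth_atlas A" and X: "vector_field A X" and Y: "vector_field A Y"
  shows "vector_field A (lie_bracket X Y)"
proof -
  note s = vector_field_smooth[OF X] vector_field_smooth[OF Y]
    smooth_fun_add[OF A] smooth_fun_mult[OF A] smooth_fun_const smooth_fun_lincomb[OF A]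
  note Xt = vector_field_tangent[OF X] and Yt = vector_field_tangent[OF Y]
  have "lie_bracket X Y p (\<lambda>q. a * h q + b * k q) = a * lie_bracket X Y p h + b * lie_bracket X Y p k"
    if "smooth_fun A h" "smooth_fun A k" for p h k a b
    using that unfolding lie_bracket_def
    by (simp add: tangent_lincomb[OF Xt] tangent_lincomb[OF Yt] s algebra_simps)
  moreover have "lie_bracket X Y p (\<lambda>q. h q * k q) = h p * lie_bracket X Y p k + k p * lie_bracket X Y p h"
    if h: "smooth_fun A h" and k: "smooth_fun A k" for p h k
  proof -
    \<comment> \<open>The two products of first derivatives are together symmetric in
      \<open>Z\<close> and \<open>W\<close>, so they cancel in the commutator.\<close>
    have *: "Z p (\<lambda>q. h q * W q k + k q * W q h) =
        h p * Z p (\<lambda>q. W q k) + W p k * Z p h + (k p * Z p (\<lambda>q. W q h) + W p h * Z p k)"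
      if Z: "vector_field A Z" and W: "vector_field A W" for Z W
    proof -
      note Zt = vector_field_tangent[OF Z]
      have "Z p (\<lambda>q. 1 * (h q * W q k) + 1 * (k q * W q h)) =
          1 * Z p (\<lambda>q. h q * W q k) + 1 * Z p (\<lambda>q. k q * W q h)"
        by (intro tangent_lincomb[OF Zt] smooth_fun_mult[OF A] vector_field_smooth[OF W] h k)
      then show ?thesis
        using h k by (simp add: tangent_mult[OF Zt] vector_field_smooth[OF W])
    qed
    show ?thesis unfolding lie_bracket_def
      by (simp add: tangent_mult[OF Xt h k] tangent_mult[OF Yt h k] *[OF X Y] *[OF Y X] algebra_simps)
  qed
  \<comment> \<open>For a non-smooth \<open>h\<close> the inner functions are constantly 0, and
    derivations kill constants.\<close>
  moreover have "lie_bracket X Y p h = 0" if "\<not> smooth_fun A h" for p h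
    using that unfolding lie_bracket_def
    by (simp add: tangent_not_smooth[OF Xt] tangent_not_smooth[OF Yt] tangent_const[OF Xt] tangent_const[OF Yt])
  moreover have "smooth_fun A (\<lambda>p. lie_bracket X Y p h)" if "smooth_fun A h" for h
    using smooth_fun_lincomb[OF A vector_field_smooth[OF X vector_field_smooth[OF Y that]]
        vector_field_smooth[OF Y vector_field_smooth[OF X that]], of 1 "-1"]
    unfolding lie_bracket_def by simp
  ultimately show ?thesis
    unfolding vector_field_def tangent_space_def by auto
qed

section \<open>Wedge products of linearly dependent arguments\<close>

text \<open>Gaussian elimination: unless the last equation is trivial, it is solved for an unknown
  \<open>k\<close> with nonzero coefficient, and the induction hypothesis handles the remaining
  unknowns and equations.\<close>

lemma homogeneous_system_nontrivial:
  fixes c :: "'i \<Rightarrow> nat \<Rightarrow> real"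
  assumes "finite I" "d < card I"
  shows "\<exists>a. (\<exists>i\<in>I. a i \<noteq> 0) \<and> (\<forall>j<d. (\<Sum>i\<in>I. a i * c i j) = 0)"
  using assms
proof (induction d arbitrary: I c)
  case 0
  then show ?case by (intro exI[of _ "\<lambda>_. 1"]) (auto simp: card_gt_0_iff)
next
  case (Suc d)
  show ?case
  proof (cases "\<forall>i\<in>I. c i d = 0")
    case True
    then have "(\<Sum>i\<in>I. a i * c i d) = 0" for a by simp
    then show ?thesis using Suc.IH[of I c] Suc.prems by (auto simp: less_Suc_eq)
  next
    case False
    then obtain k where k: "k \<in> I" "c k d \<noteq> 0" by blast
    have "d < card (I - {k})" using Suc.prems k by simp
    then obtain a where a: "\<exists>i\<in>I - {k}. a i \<noteq> 0"
      "\<And>j. j < d \<Longrightarrow> (\<Sum>i\<in>I - {k}. a i * (c i j - c i d / c k d * c k j)) = 0"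
      using Suc.IH[of "I - {k}" "\<lambda>i j. c i j - c i d / c k d * c k j"] Suc.prems(1) by auto
    \<comment> \<open>Back substitution: the value at \<open>k\<close> is the one that equation
      \<open>d\<close> dictates.\<close>
    define b where "b = a(k := - (\<Sum>i\<in>I - {k}. a i * c i d) / c k d)"
    have b: "(\<Sum>i\<in>I. b i * c i j) = b k * c k j + (\<Sum>i\<in>I - {k}. a i * c i j)" for j
      using Suc.prems(1) k(1) by (subst sum.remove[of I k]) (auto simp: b_def intro!: sum.cong)
    have "(\<Sum>i\<in>I. b i * c i j) = 0" if "j < Suc d" for j
    proof (cases "j = d")
      case True
      then show ?thesis using b[of d] k by (simp add: b_def)
    next
      case False
      have "(\<Sum>i\<in>I - {k}. a i * (c i j - c i d / c k d * c k j)) =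
          (\<Sum>i\<in>I - {k}. a i * c i j) - (\<Sum>i\<in>I - {k}. a i * c i d) / c k d * c k j"
        by (simp add: right_diff_distrib sum_subtractf sum_divide_distrib sum_distrib_right mult.assoc)
      then show ?thesis
        using a(2)[of j] b[of j] that False by (simp add: b_def)
    qed
    moreover have "\<exists>i\<in>I. b i \<noteq> 0" using a(1) by (auto simp: b_def)
    ultimately show ?thesis by blast
  qed
qed

text \<open>\<open>annihilated V m a y k \<omega>\<close>: the \<open>k\<close>-form \<open>\<omega>\<close> vanishes, as far as arguments in \<open>V\<close> are
  concerned, when the formal combination \<open>\<Sum>j<m. a j * y j\<close> is put in one of its slots.\<close>

definition annihilated ::
  "'v set \<Rightarrow> nat \<Rightarrow> (nat \<Rightarrow> real) \<Rightarrow> (nat \<Rightarrow> 'v) \<Rightarrow> nat \<Rightarrow> ((nat \<Rightarrow> 'v) \<Rightarrow> real) \<Rightarrow> bool" where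
  "annihilated V m a y k \<omega> \<longleftrightarrow>
     (\<forall>x x'. (\<forall>i<k. x i = x' i) \<longrightarrow> \<omega> x = \<omega> x') \<and>
     (\<forall>x i. (\<forall>j<k. x j \<in> V) \<longrightarrow> i < k \<longrightarrow> (\<Sum>j<m. a j * \<omega> (x(i := y j))) = 0)"

lemma annihilated_cong:
  "annihilated V m a y k \<omega> \<Longrightarrow> (\<And>i. i < k \<Longrightarrow> x i = x' i) \<Longrightarrow> \<omega> x = \<omega> x'"
  unfolding annihilated_def by blast

lemma annihilated_sum:
  "annihilated V m a y k \<omega> \<Longrightarrow> (\<And>j. j < k \<Longrightarrow> x j \<in> V) \<Longrightarrow> i < k \<Longrightarrow>
    (\<Sum>j<m. a j * \<omega> (x(i := y j))) = 0"
  unfolding annihilated_def by blast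

text \<open>In each term of the permutation sum, slot \<open>i\<close> of the product feeds exactly
  one slot of one factor. The other factor is then a constant, and the annihilation of the affected
  factor kills the term.\<close>

lemma annihilated_wedge:
  assumes \<omega>: "annihilated V m a y k \<omega>" and \<theta>: "annihilated V m a y l \<theta>"
  shows "annihilated V m a y (k + l) (wedge k l \<omega> \<theta>)"
  unfolding annihilated_def
proof (intro conjI allI impI)
  fix x x' :: "nat \<Rightarrow> 'a" assume eq: "\<forall>i<k + l. x i = x' i"
  have "of_int (sign \<sigma>) * \<omega> (\<lambda>i. x (\<sigma> i)) * \<theta> (\<lambda>i. x (\<sigma> (k + i))) =
      of_int (sign \<sigma>) * \<omega> (\<lambda>i. x' (\<sigma> i)) * \<theta> (\<lambda>i. x' (\<sigma> (k + i)))"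
    if \<sigma>: "\<sigma> permutes {..<k + l}" for \<sigma>
  proof -
    have "\<sigma> i < k + l" if "i < k + l" for i
      using permutes_in_image[OF \<sigma>, of i] that by simp
    then show ?thesis
      using eq annihilated_cong[OF \<omega>, of "\<lambda>i. x (\<sigma> i)" "\<lambda>i. x' (\<sigma> i)"]
        annihilated_cong[OF \<theta>, of "\<lambda>i. x (\<sigma> (k + i))" "\<lambda>i. x' (\<sigma> (k + i))"] by simp
  qed
  then show "wedge k l \<omega> \<theta> x = wedge k l \<omega> \<theta> x'"
    unfolding wedge_def by (intro arg_cong2[where f="(/)"] sum.cong) auto
next
  fix x :: "nat \<Rightarrow> 'a" and i assume x: "\<forall>j<k + l. x j \<in> V" and i: "i < k + l"
  let ?t = "\<lambda>\<sigma> x. of_int (sign \<sigma>) * \<omega> (\<lambda>i. x (\<sigma> i)) * \<theta> (\<lambda>i. x (\<sigma> (k + i)))"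
  have 0: "(\<Sum>j<m. a j * ?t \<sigma> (x(i := y j))) = 0" if \<sigma>: "\<sigma> permutes {..<k + l}" for \<sigma>
  proof -
    \<comment> \<open>The position that \<sigma> sends to \<open>i\<close>; whether it lies below
      \<open>k\<close> decides which factor is affected.\<close>
    define i' where "i' = inv \<sigma> i"
    have i': "\<sigma> t = i \<longleftrightarrow> t = i'" for t
      using permutes_inverses[OF \<sigma>] unfolding i'_def by metis
    have lt: "\<sigma> t < k + l" if "t < k + l" for t
      using permutes_in_image[OF \<sigma>, of t] that by simp
    have i'_lt: "i' < k + l"
      using permutes_in_image[OF permutes_inv[OF \<sigma>], of i] i by (simp add: i'_def)
    show ?thesis
    proof (cases "i' < k")
      case True
      have "?t \<sigma> (x(i := y j)) = of_int (sign \<sigma>) * \<theta> (\<lambda>t. x (\<sigma> (k + t))) *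
          \<omega> ((\<lambda>t. x (\<sigma> t))(i' := y j))" for j
      proof -
        have "(\<lambda>t. (x(i := y j)) (\<sigma> t)) = (\<lambda>t. x (\<sigma> t))(i' := y j)"
          "(\<lambda>t. (x(i := y j)) (\<sigma> (k + t))) = (\<lambda>t. x (\<sigma> (k + t)))"
          using True by (auto simp: fun_eq_iff i')
        then show ?thesis by simp
      qed
      then have "(\<Sum>j<m. a j * ?t \<sigma> (x(i := y j))) = of_int (sign \<sigma>) * \<theta> (\<lambda>t. x (\<sigma> (k + t))) *
          (\<Sum>j<m. a j * \<omega> ((\<lambda>t. x (\<sigma> t))(i' := y j)))"
        by (simp add: sum_distrib_left ac_simps)
      also have "\<dots> = 0"
        using annihilated_sum[OF \<omega>, of "\<lambda>t. x (\<sigma> t)" i'] x lt True by simp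
      finally show ?thesis .
    next
      case False
      have "?t \<sigma> (x(i := y j)) = of_int (sign \<sigma>) * \<omega> (\<lambda>t. x (\<sigma> t)) *
          \<theta> ((\<lambda>t. x (\<sigma> (k + t)))(i' - k := y j))" for j
      proof -
        have "\<omega> (\<lambda>t. (x(i := y j)) (\<sigma> t)) = \<omega> (\<lambda>t. x (\<sigma> t))"
          using False by (intro annihilated_cong[OF \<omega>]) (auto simp: i')
        moreover have "(\<lambda>t. (x(i := y j)) (\<sigma> (k + t))) = (\<lambda>t. x (\<sigma> (k + t)))(i' - k := y j)"
          using False by (auto simp: fun_eq_iff i')
        ultimately show ?thesis by simp
      qed
      then have "(\<Sum>j<m. a j * ?t \<sigma> (x(i := y j))) = of_int (sign \<sigma>) * \<omega> (\<lambda>t. x (\<sigma> t)) *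
          (\<Sum>j<m. a j * \<theta> ((\<lambda>t. x (\<sigma> (k + t)))(i' - k := y j)))"
        by (simp add: sum_distrib_left ac_simps)
      also have "\<dots> = 0"
        using annihilated_sum[OF \<theta>, of "\<lambda>t. x (\<sigma> (k + t))" "i' - k"] x lt False i'_lt by simp
      finally show ?thesis .
    qed
  qed
  have "(\<Sum>j<m. a j * wedge k l \<omega> \<theta> (x(i := y j))) =
      (\<Sum>j<m. \<Sum>\<sigma> | \<sigma> permutes {..<k + l}. a j * ?t \<sigma> (x(i := y j))) / fact (k + l)"
    unfolding wedge_def by (simp add: sum_distrib_left sum_divide_distrib)
  also have "(\<Sum>j<m. \<Sum>\<sigma> | \<sigma> permutes {..<k + l}. a j * ?t \<sigma> (x(i := y j))) =
      (\<Sum>\<sigma> | \<sigma> permutes {..<k + l}. \<Sum>j<m. a j * ?t \<sigma> (x(i := y j)))"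
    by (rule sum.swap)
  also have "\<dots> = 0"
    by (rule sum.neutral) (use 0 in blast)
  finally show "(\<Sum>j<m. a j * wedge k l \<omega> \<theta> (x(i := y j))) = 0" by (simp only: div_0)
qed

lemma annihilated_wedge_upto:
  assumes "\<And>r. r \<in> {1..q} \<Longrightarrow> annihilated V m a y d (\<Omega> r)"
  shows "annihilated V m a y (q * d) (wedge_upto d \<Omega> q)"
  using assms
proof (induction q)
  case 0
  then show ?case by (simp add: annihilated_def)
next
  case (Suc q)
  then have "annihilated V m a y (q * d + d) (wedge (q * d) d (wedge_upto d \<Omega> q) (\<Omega> (Suc q)))"
    by (intro annihilated_wedge) auto
  then show ?case by (simp add: add.commute)
qed

text \<open>Reindexing of the antisymmetrizing sum by left composition with \<tau>.\<close>

lemma wedge_permute: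
  assumes \<tau>: "\<tau> permutes {..<k + l}"
  shows "wedge k l \<omega> \<theta> (\<lambda>i. x (\<tau> i)) = of_int (sign \<tau>) * wedge k l \<omega> \<theta> x"
proof -
  let ?t = "\<lambda>\<sigma>. of_int (sign \<sigma>) * \<omega> (\<lambda>i. x (\<sigma> i)) * \<theta> (\<lambda>i. x (\<sigma> (k + i)))"
  have "(\<Sum>\<sigma> | \<sigma> permutes {..<k + l}. ?t \<sigma>) = (\<Sum>\<sigma> | \<sigma> permutes {..<k + l}. ?t (\<tau> \<circ> \<sigma>))"
    by (rule setum_permutations_compose_left[OF \<tau>])
  also have "\<dots> = (\<Sum>\<sigma> | \<sigma> permutes {..<k + l}. of_int (sign \<tau>) *
      (of_int (sign \<sigma>) * \<omega> (\<lambda>i. x (\<tau> (\<sigma> i))) * \<theta> (\<lambda>i. x (\<tau> (\<sigma> (k + i))))))"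
  proof (intro sum.cong refl)
    fix \<sigma> assume "\<sigma> \<in> {\<sigma>. \<sigma> permutes {..<k + l}}"
    then have "sign (\<tau> \<circ> \<sigma>) = sign \<tau> * sign \<sigma>"
      using \<tau> by (intro sign_compose permutes_imp_permutation[of "{..<k + l}"]) auto
    then show "?t (\<tau> \<circ> \<sigma>) = of_int (sign \<tau>) *
      (of_int (sign \<sigma>) * \<omega> (\<lambda>i. x (\<tau> (\<sigma> i))) * \<theta> (\<lambda>i. x (\<tau> (\<sigma> (k + i)))))" by simp
  qed
  finally have "wedge k l \<omega> \<theta> x = of_int (sign \<tau>) * wedge k l \<omega> \<theta> (\<lambda>i. x (\<tau> i))"
    unfolding wedge_def by (simp add: sum_distrib_left)
  moreover have "of_int (sign \<tau>) * of_int (sign \<tau>) = (1 :: real)"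
    by (metis of_int_1 of_int_mult sign_idempotent)
  ultimately show ?thesis by (simp flip: mult.assoc)
qed

text \<open>The transposition of the two slots fixes \<open>x\<close> and is odd, so the value is
  its own negative.\<close>

lemma wedge_repeated_arg:
  assumes "i < k + l" "j < k + l" "i \<noteq> j" "x i = x j"
  shows "wedge k l \<omega> \<theta> x = 0"
proof -
  have "(\<lambda>t. x (Transposition.transpose i j t)) = x"
    using assms(4) by (auto simp: Transposition.transpose_def)
  then show ?thesis
    using wedge_permute[of "Transposition.transpose i j" k l \<omega> \<theta> x] assms
      permutes_swap_id[of i "{..<k + l}" j] by (simp add: sign_swap_id)
qed

text \<open>Put the dependency into slot \<open>i\<close>: every term with \<open>j\<close>
  different from \<open>i\<close> repeats the argument \<open>x j\<close>, so the vanishing sum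
  reduces to \<open>a i\<close> times the value at \<open>x\<close>.\<close>

lemma wedge_dependent_args:
  assumes ann: "annihilated V (k + l) a x (k + l) (wedge k l \<omega> \<theta>)"
    and x: "\<And>j. j < k + l \<Longrightarrow> x j \<in> V" and i: "i < k + l" "a i \<noteq> 0"
  shows "wedge k l \<omega> \<theta> x = 0"
proof -
  have "wedge k l \<omega> \<theta> (x(i := x j)) = 0" if "j < k + l" "j \<noteq> i" for j
    using wedge_repeated_arg[of i k l j "x(i := x j)"] that i by simp
  then have "(\<Sum>j<k + l. a j * wedge k l \<omega> \<theta> (x(i := x j))) =
      (\<Sum>j<k + l. if j = i then a i * wedge k l \<omega> \<theta> x else 0)"
    by (intro sum.cong) auto
  also have "\<dots> = a i * wedge k l \<omega> \<theta> x" using i by simp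
  finally show ?thesis using annihilated_sum[OF ann x i(1)] i(2) by simp
qed

section \<open>The connection of an S-manifold\<close>

locale s_manifold =
  fixes A :: "('m::{t2_space,second_countable_topology}, 'e::euclidean_space) atlas"
    and f :: "'m \<Rightarrow> 'm tvec \<Rightarrow> 'm tvec"
    and \<xi> :: "nat \<Rightarrow> 'm vfield"
    and \<eta> :: "nat \<Rightarrow> 'm \<Rightarrow> 'm tvec \<Rightarrow> real"
    and g :: "'m \<Rightarrow> 'm tvec \<Rightarrow> 'm tvec \<Rightarrow> real"
    and D :: "'m vfield \<Rightarrow> 'm vfield \<Rightarrow> 'm vfield"
    and n s :: nat
  assumes S_manifold: "S_manifold n s A f \<xi> \<eta> g"
    and connection: "riemannian_connection A g D"
begin

abbreviation VF :: "'m vfield \<Rightarrow> bool" where "VF \<equiv> vector_field A"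

abbreviation F :: "'m vfield \<Rightarrow> 'm vfield" where "F \<equiv> app_field f"

text \<open>Most identities between vector fields below are stated weakly, through their products
  \<open>G _ W p\<close> with test fields \<open>W\<close>; linear reasoning then takes place in the
  reals.\<close>

definition G :: "'m vfield \<Rightarrow> 'm vfield \<Rightarrow> 'm \<Rightarrow> real" where
  "G X Y = (\<lambda>p. g p (X p) (Y p))"

section \<open>Pointwise algebra of g, f and the structure fields\<close>

lemma metric_f: "metric_f_manifold n s A f \<xi> \<eta> g"
  using S_manifold unfolding S_manifold_def by blast

lemma atlas: "smooth_atlas A"
  and tensor_f: "tensor_field_1_1 A f"
  and metric: "riemannian_metric A g"
  and s_pos: "1 \<le> s"
  using metric_f unfolding metric_f_manifold_def by blast+

lemma affine: "affine_connection A D"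
  using connection unfolding riemannian_connection_def by blast

lemma f_pointwise:
  assumes "v \<in> tangent_space A p"
  shows "\<alpha> \<in> {1..s} \<Longrightarrow> \<eta> \<alpha> p v = g p v (\<xi> \<alpha> p)"
    and "\<alpha> \<in> {1..s} \<Longrightarrow> \<eta> \<alpha> p (f p v) = 0"
    and "w \<in> tangent_space A p \<Longrightarrow> g p v (f p w) = - g p (f p v) w"
    and "w \<in> tangent_space A p \<Longrightarrow>
      g p (f p v) (f p w) = g p v w - (\<Sum>\<alpha>=1..s. \<eta> \<alpha> p v * \<eta> \<alpha> p w)"
  using assms metric_f unfolding metric_f_manifold_def by blast+

lemma eta_xi: "\<alpha> \<in> {1..s} \<Longrightarrow> \<beta> \<in> {1..s} \<Longrightarrow> \<eta> \<alpha> p (\<xi> \<beta> p) = (if \<alpha> = \<beta> then 1 else 0)"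
  and f_xi: "\<alpha> \<in> {1..s} \<Longrightarrow> f p (\<xi> \<alpha> p) = (\<lambda>_. 0)"
  using metric_f unfolding metric_f_manifold_def by blast+

lemma F_apply: "F X p = f p (X p)"
  by (simp add: app_field_def)

lemma VF_xi [simp]: "\<alpha> \<in> {1..s} \<Longrightarrow> VF (\<xi> \<alpha>)"
  using metric_f unfolding metric_f_manifold_def by blast

lemma VF_F [simp]: "VF X \<Longrightarrow> VF (F X)"
  using tensor_f unfolding tensor_field_1_1_def app_field_def by blast

lemma VF_D [simp]: "VF X \<Longrightarrow> VF Y \<Longrightarrow> VF (D X Y)"
  using affine unfolding affine_connection_def by blast

lemma VF_bracket [simp]: "VF X \<Longrightarrow> VF Y \<Longrightarrow> VF (lie_bracket X Y)"
  using vector_field_lie_bracket atlas by blast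

lemma VF_lincomb [simp]: "VF X \<Longrightarrow> VF Y \<Longrightarrow> VF (\<lambda>p h. a * X p h + b * Y p h)"
  using vector_field_lincomb atlas by blast

lemma tangent [simp]: "VF X \<Longrightarrow> X p \<in> tangent_space A p"
  by (rule vector_field_tangent)

lemma smooth_G [simp]: "VF X \<Longrightarrow> VF Y \<Longrightarrow> smooth_fun A (G X Y)"
  using metric unfolding riemannian_metric_def G_def by blast

lemma smooth_deriv [simp]: "VF X \<Longrightarrow> smooth_fun A h \<Longrightarrow> smooth_fun A (\<lambda>p. X p h)"
  by (rule vector_field_smooth)

lemma G_commute: "VF X \<Longrightarrow> VF Y \<Longrightarrow> G X Y p = G Y X p"
  using metric tangent unfolding riemannian_metric_def G_def by blast

lemma g_lincomb:
  assumes "u \<in> tangent_space A p" "v \<in> tangent_space A p" "w \<in> tangent_space A p"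
  shows "g p (\<lambda>h. a * u h + b * v h) w = a * g p u w + b * g p v w"
  using metric assms unfolding riemannian_metric_def by blast

lemma G_lincomb_left:
  "VF X \<Longrightarrow> VF Y \<Longrightarrow> VF Z \<Longrightarrow>
    G (\<lambda>p h. a * X p h + b * Y p h) Z p = a * G X Z p + b * G Y Z p"
  unfolding G_def by (intro g_lincomb) auto

lemma G_lincomb_right:
  "VF X \<Longrightarrow> VF Y \<Longrightarrow> VF Z \<Longrightarrow>
    G Z (\<lambda>p h. a * X p h + b * Y p h) p = a * G Z X p + b * G Z Y p"
  using G_lincomb_left[of X Y Z] by (simp add: G_commute[of Z])

lemma G_zero_left: "VF Y \<Longrightarrow> X p = (\<lambda>_. 0) \<Longrightarrow> G X Y p = 0"
  using g_lincomb[of "Y p" p "Y p" "Y p" 0 0] by (simp add: G_def)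

lemma G_pos: "VF X \<Longrightarrow> X p \<noteq> (\<lambda>_. 0) \<Longrightarrow> 0 < G X X p"
  using metric tangent unfolding riemannian_metric_def G_def by blast

lemma G_nonneg: "VF X \<Longrightarrow> 0 \<le> G X X p"
  using G_pos[of X p] G_zero_left[of X X p] by force

lemma eta_eq_G: "VF X \<Longrightarrow> \<alpha> \<in> {1..s} \<Longrightarrow> \<eta> \<alpha> p (X p) = G X (\<xi> \<alpha>) p"
  unfolding G_def by (simp add: f_pointwise(1))

lemma G_xi_xi: "\<alpha> \<in> {1..s} \<Longrightarrow> \<beta> \<in> {1..s} \<Longrightarrow> G (\<xi> \<alpha>) (\<xi> \<beta>) p = (if \<alpha> = \<beta> then 1 else 0)"
  using eta_eq_G[of "\<xi> \<alpha>" \<beta> p] eta_xi[of \<beta> \<alpha> p] by auto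

lemma F_xi [simp]: "\<alpha> \<in> {1..s} \<Longrightarrow> F (\<xi> \<alpha>) = (\<lambda>p h. 0)"
  using f_xi unfolding app_field_def by blast

lemma G_F_xi [simp]: "VF X \<Longrightarrow> \<alpha> \<in> {1..s} \<Longrightarrow> G (F X) (\<xi> \<alpha>) p = 0"
  using eta_eq_G[of "F X" \<alpha> p] f_pointwise(2)[OF tangent, of X \<alpha> p] by (simp add: F_apply)

lemma G_xi_F [simp]: "VF X \<Longrightarrow> \<alpha> \<in> {1..s} \<Longrightarrow> G (\<xi> \<alpha>) (F X) p = 0"
  by (simp add: G_commute[of "\<xi> \<alpha>"])

lemma G_F_right: "VF X \<Longrightarrow> VF Y \<Longrightarrow> G X (F Y) p = - G (F X) Y p"
  unfolding G_def app_field_def by (simp add: f_pointwise(3))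

lemma G_F_F:
  "VF X \<Longrightarrow> VF Y \<Longrightarrow>
    G (F X) (F Y) p = G X Y p - (\<Sum>\<alpha>=1..s. G X (\<xi> \<alpha>) p * G Y (\<xi> \<alpha>) p)"
  using f_pointwise(4)[of "X p" p "Y p"]
  by (simp add: eta_eq_G) (simp add: G_def app_field_def)

text \<open>The weak form of the formula for f^2, here a consequence of skewness of f and its
  compatibility with g.\<close>

lemma G_FF_left:
  "VF X \<Longrightarrow> VF Y \<Longrightarrow> G (F (F X)) Y p = (\<Sum>\<alpha>=1..s. G X (\<xi> \<alpha>) p * G Y (\<xi> \<alpha>) p) - G X Y p"
  using G_F_right[of "F X" Y p] G_F_F[of X Y p] by simp

lemma G_F_self: "VF X \<Longrightarrow> G X (F X) p = 0"
  using G_F_right[of X X p] G_commute[of "F X" X p] by simp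

lemma F_lincomb:
  "VF X \<Longrightarrow> VF Y \<Longrightarrow> F (\<lambda>p h. a * X p h + b * Y p h) = (\<lambda>p h. a * F X p h + b * F Y p h)"
  using tensor_f tangent[of X] tangent[of Y] unfolding tensor_field_1_1_def app_field_def by fastforce

section \<open>Rules for derivatives of functions, brackets and the connection\<close>

lemma deriv_lincomb:
  "VF X \<Longrightarrow> smooth_fun A h \<Longrightarrow> smooth_fun A k \<Longrightarrow> X p (\<lambda>q. a * h q + b * k q) = a * X p h + b * X p k"
  by (rule tangent_lincomb[OF tangent])

lemma deriv_const: "VF X \<Longrightarrow> X p (\<lambda>q. c) = 0"
  by (rule tangent_const[OF tangent])

lemma deriv_uminus: "VF X \<Longrightarrow> smooth_fun A h \<Longrightarrow> X p (\<lambda>q. - h q) = - X p h"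
  using deriv_lincomb[of X h h p "-1" 0] by simp

lemma deriv_diff:
  "VF X \<Longrightarrow> smooth_fun A h \<Longrightarrow> smooth_fun A k \<Longrightarrow> X p (\<lambda>q. h q - k q) = X p h - X p k"
  using deriv_lincomb[of X h k p 1 "-1"] by simp

lemma smooth_diff: "smooth_fun A h \<Longrightarrow> smooth_fun A k \<Longrightarrow> smooth_fun A (\<lambda>q. h q - k q)"
  using smooth_fun_lincomb[OF atlas, of h k 1 "-1"] by simp

lemma D_metric:
  "VF X \<Longrightarrow> VF Y \<Longrightarrow> VF Z \<Longrightarrow> X p (G Y Z) = G (D X Y) Z p + G Y (D X Z) p"
  using connection unfolding riemannian_connection_def G_def by blast

lemma bracket_apply: "lie_bracket X Y p h = X p (\<lambda>q. Y q h) - Y p (\<lambda>q. X q h)"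
  by (simp add: lie_bracket_def)

lemma D_torsion:
  assumes "VF X" "VF Y" "VF Z"
  shows "G (lie_bracket X Y) Z p = G (D X Y) Z p - G (D Y X) Z p"
proof -
  have "lie_bracket X Y = (\<lambda>p h. 1 * D X Y p h + (-1) * D Y X p h)"
    using connection assms unfolding riemannian_connection_def by (simp add: fun_eq_iff)
  then show ?thesis
    using G_lincomb_left[of "D X Y" "D Y X" Z 1 "-1" p] assms by simp
qed

text \<open>On a smooth \<open>h\<close> each double bracket unfolds into iterated derivatives,
  which cancel in the cyclic sum; on a non-smooth \<open>h\<close> all brackets are 0.\<close>

lemma jacobi:
  assumes X: "VF X" and Y: "VF Y" and Z: "VF Z" and W: "VF W"
  shows "G (lie_bracket (lie_bracket X Y) Z) W p + G (lie_bracket (lie_bracket Y Z) X) W p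
    + G (lie_bracket (lie_bracket Z X) Y) W p = 0"
proof -
  have *: "lie_bracket (lie_bracket X Y) Z p h =
      X p (\<lambda>q. Y q (\<lambda>r. Z r h)) - Y p (\<lambda>q. X q (\<lambda>r. Z r h))
      - (Z p (\<lambda>q. X q (\<lambda>r. Y r h)) - Z p (\<lambda>q. Y q (\<lambda>r. X r h)))"
    if "VF X" "VF Y" "VF Z" "smooth_fun A h" for X Y Z h
    using that smooth_deriv[OF that(1)] smooth_deriv[OF that(2)]
    by (simp add: bracket_apply deriv_diff[OF that(3)])
  have "lie_bracket (lie_bracket Z X) Y p h =
    (-1) * lie_bracket (lie_bracket X Y) Z p h + (-1) * lie_bracket (lie_bracket Y Z) X p h" for h
  proof (cases "smooth_fun A h")
    case True
    then show ?thesis using X Y Z by (simp add: *)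
  next
    case False
    have "lie_bracket (lie_bracket X Y) Z p h = 0" if "VF X" "VF Y" "VF Z" for X Y Z
      using that by (intro tangent_not_smooth[OF tangent False]) simp
    then show ?thesis using X Y Z by simp
  qed
  then have "lie_bracket (lie_bracket Z X) Y p =
    (\<lambda>h. (-1) * lie_bracket (lie_bracket X Y) Z p h + (-1) * lie_bracket (lie_bracket Y Z) X p h)"
    by (rule ext)
  then show ?thesis
    using g_lincomb[of "lie_bracket (lie_bracket X Y) Z p" p "lie_bracket (lie_bracket Y Z) X p" "W p" "-1" "-1"]
      X Y Z W by (simp add: G_def)
qed

section \<open>The S-manifold conditions in terms of brackets\<close>

lemma ext_deriv_eq_G:
  assumes "VF X" "VF Y" "\<alpha> \<in> {1..s}"
  shows "ext_deriv (\<eta> \<alpha>) X Y p = G X (F Y) p"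
proof -
  have "fundamental_form f g X Y = ext_deriv (\<eta> \<alpha>) X Y"
    using S_manifold assms unfolding S_manifold_def by blast
  from fun_cong[OF this, of p] show ?thesis
    by (simp add: fundamental_form_def G_def F_apply)
qed

lemma d_eta:
  assumes "VF X" "VF Y" "\<alpha> \<in> {1..s}"
  shows "2 * G X (F Y) p = X p (G Y (\<xi> \<alpha>)) - Y p (G X (\<xi> \<alpha>)) - G (lie_bracket X Y) (\<xi> \<alpha>) p"
  using assms by (simp add: ext_deriv_eq_G[OF assms, symmetric] ext_deriv_def eta_eq_G)

text \<open>Since \<Phi> is the differential of the first 1-form, this is d d = 0. The second
  derivatives match those in \<open>d_eta\<close> for the brackets, and what remains is the Jacobi
  identity.\<close>

lemma d_Phi_eq_0:
  assumes X: "VF X" and Y: "VF Y" and Z: "VF Z"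
  shows "X p (G Y (F Z)) + Y p (G Z (F X)) + Z p (G X (F Y)) =
    G (lie_bracket X Y) (F Z) p + G (lie_bracket Y Z) (F X) p + G (lie_bracket Z X) (F Y) p"
proof -
  have 1: "1 \<in> {1..s}" using s_pos by simp
  have *: "2 * X p (G Y (F Z)) =
      X p (\<lambda>q. Y q (G Z (\<xi> 1))) - X p (\<lambda>q. Z q (G Y (\<xi> 1))) - X p (G (lie_bracket Y Z) (\<xi> 1))"
    if "VF X" "VF Y" "VF Z" for X Y Z
  proof -
    have "2 * X p (G Y (F Z)) = X p (\<lambda>q. 2 * G Y (F Z) q)"
      using deriv_lincomb[of X "G Y (F Z)" "G Y (F Z)" p 2 0] that by simp
    also have "\<dots> = X p (\<lambda>q. Y q (G Z (\<xi> 1)) - Z q (G Y (\<xi> 1)) - G (lie_bracket Y Z) (\<xi> 1) q)"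
      by (simp only: d_eta[OF that(2,3) 1])
    finally show ?thesis
      using that VF_xi[OF 1] deriv_diff[of X "\<lambda>q. Y q (G Z (\<xi> 1)) - Z q (G Y (\<xi> 1))" "G (lie_bracket Y Z) (\<xi> 1)" p]
        deriv_diff[of X "\<lambda>q. Y q (G Z (\<xi> 1))" "\<lambda>q. Z q (G Y (\<xi> 1))" p]
        smooth_deriv[OF that(2)] smooth_deriv[OF that(3)] smooth_diff
      by auto
  qed
  show ?thesis
    using *[OF X Y Z] *[OF Y Z X] *[OF Z X Y] jacobi[OF X Y Z VF_xi[OF 1], of p]
      d_eta[OF VF_bracket[OF X Y] Z 1, of p] d_eta[OF VF_bracket[OF Y Z] X 1, of p]
      d_eta[OF VF_bracket[OF Z X] Y 1, of p]
    by (simp add: bracket_apply)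
qed

lemma VF_zero [simp]: "VF (\<lambda>p h. 0)"
  by (rule vector_field_zero)

lemma F_zero [simp]: "F (\<lambda>p h. 0) = (\<lambda>p h. 0)"
  using F_lincomb[of "\<lambda>p h. 0" "\<lambda>p h. 0" 0 0] by simp

lemma G_zero [simp]: "VF X \<Longrightarrow> G (\<lambda>p h. 0) X p = 0" "VF X \<Longrightarrow> G X (\<lambda>p h. 0) p = 0"
  by (auto simp: G_zero_left G_commute[of X])

lemma bracket_zero [simp]: "VF X \<Longrightarrow> lie_bracket X (\<lambda>p h. 0) = (\<lambda>p h. 0)"
  "VF X \<Longrightarrow> lie_bracket (\<lambda>p h. 0) X = (\<lambda>p h. 0)"
  by (auto simp: bracket_apply deriv_const fun_eq_iff)

text \<open>Tangency of the partial sums is part of the conclusion because linearity of g in the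
  induction step asks for it.\<close>

lemma g_sum_left:
  assumes "finite I" "\<And>i. i \<in> I \<Longrightarrow> V i \<in> tangent_space A p" "w \<in> tangent_space A p"
  shows "(\<lambda>h. \<Sum>i\<in>I. c i * V i h) \<in> tangent_space A p \<and>
    g p (\<lambda>h. \<Sum>i\<in>I. c i * V i h) w = (\<Sum>i\<in>I. c i * g p (V i) w)"
  using assms
proof (induction I)
  case empty
  then show ?case
    using tangent_space_lincomb[OF atlas, of w p w 0 0] g_lincomb[of w p w w 0 0] by simp
next
  case (insert i I)
  let ?u = "\<lambda>h. \<Sum>i\<in>I. c i * V i h"
  have "?u \<in> tangent_space A p" "V i \<in> tangent_space A p" using insert by auto
  with tangent_space_lincomb[OF atlas this(2,1), of "c i" 1] g_lincomb[OF this(2,1) insert.prems(2), of "c i" 1]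
  show ?case using insert by simp
qed

lemma normality:
  assumes X: "VF X" and Y: "VF Y" and Z: "VF Z"
  shows "G (F (F (lie_bracket X Y))) Z p + G (lie_bracket (F X) (F Y)) Z p
    - G (F (lie_bracket (F X) Y)) Z p - G (F (lie_bracket X (F Y))) Z p =
    - 2 * (\<Sum>\<alpha>=1..s. G X (F Y) p * G (\<xi> \<alpha>) Z p)"
proof -
  have "nijenhuis f X Y p h + 2 * (\<Sum>\<alpha>=1..s. G X (F Y) p * \<xi> \<alpha> p h) = 0" for h
  proof -
    have "nijenhuis f X Y p h + 2 * (\<Sum>\<alpha>=1..s. ext_deriv (\<eta> \<alpha>) X Y p * \<xi> \<alpha> p h) = 0"
      using S_manifold X Y unfolding S_manifold_def normal_structure_def by blast
    moreover have "(\<Sum>\<alpha>=1..s. ext_deriv (\<eta> \<alpha>) X Y p * \<xi> \<alpha> p h) = (\<Sum>\<alpha>=1..s. G X (F Y) p * \<xi> \<alpha> p h)"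
      by (intro sum.cong refl) (metis ext_deriv_eq_G[OF X Y])
    ultimately show ?thesis by simp
  qed
  \<comment> \<open>Normality is solved for one term and grouped into nested two-term combinations,
    the shape that \<open>g_lincomb\<close> splits.\<close>
  then have "F (lie_bracket (F X) Y) p h =
     1 * (1 * F (F (lie_bracket X Y)) p h + 1 * lie_bracket (F X) (F Y) p h)
     + 1 * ((-1) * F (lie_bracket X (F Y)) p h + 2 * (\<Sum>\<alpha>=1..s. G X (F Y) p * \<xi> \<alpha> p h))" for h
    by (simp add: nijenhuis_def algebra_simps)
  then have eq: "F (lie_bracket (F X) Y) p = (\<lambda>h.
     1 * (1 * F (F (lie_bracket X Y)) p h + 1 * lie_bracket (F X) (F Y) p h)
     + 1 * ((-1) * F (lie_bracket X (F Y)) p h + 2 * (\<Sum>\<alpha>=1..s. G X (F Y) p * \<xi> \<alpha> p h)))"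
    by (rule ext)
  have t: "F (F (lie_bracket X Y)) p \<in> tangent_space A p" "lie_bracket (F X) (F Y) p \<in> tangent_space A p"
    "F (lie_bracket X (F Y)) p \<in> tangent_space A p" "Z p \<in> tangent_space A p"
    "(\<lambda>h. \<Sum>\<alpha>=1..s. G X (F Y) p * \<xi> \<alpha> p h) \<in> tangent_space A p"
    using X Y Z g_sum_left[of "{1..s}" "\<lambda>\<alpha>. \<xi> \<alpha> p" p "Z p" "\<lambda>_. G X (F Y) p"] by auto
  show ?thesis
    unfolding G_def[of "F (lie_bracket (F X) Y)"] eq
    using g_lincomb[OF tangent_space_lincomb[OF atlas t(1,2)] tangent_space_lincomb[OF atlas t(3,5)] t(4), of 1 1 1 1 "-1" 2]
      g_lincomb[OF t(1,2,4), of 1 1] g_lincomb[OF t(3,5,4), of "-1" 2]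
      g_sum_left[of "{1..s}" "\<lambda>\<alpha>. \<xi> \<alpha> p" p "Z p" "\<lambda>_. G X (F Y) p"] t
    by (simp add: G_def)
qed

section \<open>Brackets and covariant derivatives of the structure fields\<close>

text \<open>In \<open>d_eta\<close> for \<open>F X\<close> and \<open>\<xi> \<alpha>\<close> the
  left side contains f applied to \<open>\<xi> \<alpha>\<close>, and both differentiated functions
  are constant.\<close>

lemma G_bracket_F_xi_xi:
  assumes "VF X" "\<alpha> \<in> {1..s}" "\<beta> \<in> {1..s}"
  shows "G (lie_bracket (F X) (\<xi> \<alpha>)) (\<xi> \<beta>) p = 0"
proof -
  have "G (\<xi> \<alpha>) (\<xi> \<beta>) = (\<lambda>p. if \<alpha> = \<beta> then 1 else 0)" "G (F X) (\<xi> \<beta>) = (\<lambda>p. 0)"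
    using assms by (auto simp: G_xi_xi)
  then show ?thesis
    using d_eta[of "F X" "\<xi> \<alpha>" \<beta> p] assms by (simp add: deriv_const)
qed

text \<open>That is, \<open>[f X, \<xi> \<alpha>] = f [X, \<xi> \<alpha>]\<close>: the Lie derivative of \<open>f\<close> along \<open>\<xi> \<alpha>\<close> vanishes.\<close>

lemma bracket_F_xi:
  assumes X: "VF X" and Z: "VF Z" and \<alpha>: "\<alpha> \<in> {1..s}"
  shows "G (lie_bracket (F X) (\<xi> \<alpha>)) Z p = - G (lie_bracket X (\<xi> \<alpha>)) (F Z) p"
proof -
  \<comment> \<open>Normality for X and \<open>\<xi> \<alpha>\<close>, tested on f Z: every term
    that contains f applied to \<open>\<xi> \<alpha>\<close> is zero.\<close>
  have "G (F (F (lie_bracket X (\<xi> \<alpha>)))) (F Z) p = G (F (lie_bracket (F X) (\<xi> \<alpha>))) (F Z) p"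
    using normality[OF X VF_xi[OF \<alpha>], of "F Z" p] assms by simp
  \<comment> \<open>The outer f can be cancelled because the bracket of f X and
    \<open>\<xi> \<alpha>\<close> has no components along the structure fields.\<close>
  then show ?thesis
    using assms G_F_F[of "F (lie_bracket X (\<xi> \<alpha>))" Z p] G_F_F[of "lie_bracket (F X) (\<xi> \<alpha>)" Z p]
      G_F_right[of "lie_bracket X (\<xi> \<alpha>)" Z p]
    by (simp add: G_bracket_F_xi_xi)
qed

text \<open>The structure fields commute: the components along them vanish by \<open>d_eta\<close>,
  the horizontal part by \<open>bracket_F_xi\<close>, as f kills
  \<open>\<xi> \<alpha>\<close>.\<close>

lemma G_bracket_xi_xi:
  assumes "\<alpha> \<in> {1..s}" "\<beta> \<in> {1..s}" "VF Z"
  shows "G (lie_bracket (\<xi> \<alpha>) (\<xi> \<beta>)) Z p = 0"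
proof -
  let ?V = "lie_bracket (\<xi> \<alpha>) (\<xi> \<beta>)"
  have V: "VF ?V" using assms by simp
  have "G ?V (\<xi> \<gamma>) p = 0" if "\<gamma> \<in> {1..s}" for \<gamma>
  proof -
    have "G (\<xi> \<alpha>) (\<xi> \<gamma>) = (\<lambda>p. if \<alpha> = \<gamma> then 1 else 0)" "G (\<xi> \<beta>) (\<xi> \<gamma>) = (\<lambda>p. if \<beta> = \<gamma> then 1 else 0)"
      using assms that by (auto simp: G_xi_xi)
    then show ?thesis
      using d_eta[of "\<xi> \<alpha>" "\<xi> \<beta>" \<gamma> p] assms that by (simp add: deriv_const)
  qed
  moreover have "G ?V (F (F Z)) p = 0"
    using bracket_F_xi[of "\<xi> \<alpha>" "F Z" \<beta> p] assms by simp
  ultimately show ?thesis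
    using G_FF_left[OF assms(3) V, of p] G_commute[of ?V Z p] G_commute[of ?V "F (F Z)" p] assms
    by simp
qed

lemma d_eta_D:
  assumes "VF X" "VF Y" "\<alpha> \<in> {1..s}"
  shows "2 * G X (F Y) p = G Y (D X (\<xi> \<alpha>)) p - G X (D Y (\<xi> \<alpha>)) p"
  using d_eta[OF assms, of p] D_metric[of X Y "\<xi> \<alpha>" p] D_metric[of Y X "\<xi> \<alpha>" p]
    D_torsion[of X Y "\<xi> \<alpha>" p] assms by simp

text \<open>The Killing equation for \<open>\<xi> \<alpha>\<close> on the pair X, f Y. Closedness of
  \<Phi>, together with \<Phi>(\<open>\<xi> \<alpha>\<close>, _) = 0, makes the Lie derivative of
  \<Phi> along \<open>\<xi> \<alpha>\<close> vanish; that of f vanishes by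
  \<open>bracket_F_xi\<close>.\<close>

lemma killing_F:
  assumes X: "VF X" and Y: "VF Y" and \<alpha>: "\<alpha> \<in> {1..s}"
  shows "G (D X (\<xi> \<alpha>)) (F Y) p + G X (D (F Y) (\<xi> \<alpha>)) p = 0"
proof -
  note x = VF_xi[OF \<alpha>]
  have z: "G Y (F (\<xi> \<alpha>)) = (\<lambda>p. 0)" "G (\<xi> \<alpha>) (F X) = (\<lambda>p. 0)"
    using X Y \<alpha> by auto
  have "\<xi> \<alpha> p (G X (F Y)) = G (lie_bracket (\<xi> \<alpha>) X) (F Y) p + G (lie_bracket Y (\<xi> \<alpha>)) (F X) p"
    using d_Phi_eq_0[OF x X Y, of p] X Y \<alpha> unfolding z by (simp add: deriv_const)
  then show ?thesis
    using D_metric[OF x X VF_F[OF Y], of p] D_torsion[OF x X VF_F[OF Y], of p]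
      bracket_F_xi[OF Y X \<alpha>, of p] D_torsion[OF VF_F[OF Y] x X, of p] X Y x
    by (simp add: G_commute[of X])
qed

text \<open>The left side is skew in \<alpha>, \<beta> by metric compatibility. By
  \<open>d_eta_D\<close> it also equals the product of X with the derivative of
  \<open>\<xi> \<alpha>\<close> along \<open>\<xi> \<beta>\<close>, which is symmetric as the
  structure fields commute.\<close>

lemma D_xi_xi:
  assumes X: "VF X" and \<alpha>: "\<alpha> \<in> {1..s}" and \<beta>: "\<beta> \<in> {1..s}"
  shows "G (D X (\<xi> \<alpha>)) (\<xi> \<beta>) p = 0"
proof -
  note x = VF_xi[OF \<alpha>] VF_xi[OF \<beta>]
  have "G (\<xi> \<alpha>) (\<xi> \<beta>) = (\<lambda>p. if \<alpha> = \<beta> then 1 else 0)"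
    using \<alpha> \<beta> by (auto simp: G_xi_xi)
  then have "G (D X (\<xi> \<alpha>)) (\<xi> \<beta>) p + G (D X (\<xi> \<beta>)) (\<xi> \<alpha>) p = 0"
    using D_metric[OF X x, of p] X x by (simp add: deriv_const G_commute[of "\<xi> \<alpha>"])
  moreover have "G (D X (\<xi> \<alpha>)) (\<xi> \<beta>) p = G X (D (\<xi> \<beta>) (\<xi> \<alpha>)) p"
    "G (D X (\<xi> \<beta>)) (\<xi> \<alpha>) p = G X (D (\<xi> \<alpha>) (\<xi> \<beta>)) p"
    using d_eta_D[OF X x(2) \<alpha>, of p] d_eta_D[OF X x(1) \<beta>, of p] X x \<alpha> \<beta>
    by (simp_all add: G_commute[of "\<xi> _"])
  moreover have "G X (D (\<xi> \<beta>) (\<xi> \<alpha>)) p = G X (D (\<xi> \<alpha>) (\<xi> \<beta>)) p"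
    using D_torsion[OF x X, of p] G_bracket_xi_xi[OF \<alpha> \<beta> X, of p] X x by (simp add: G_commute[of X])
  ultimately show ?thesis by simp
qed

text \<open>That is, \<open>\<nabla>\<^sub>X \<xi> \<alpha> = - f X\<close>.\<close>

lemma D_xi:
  assumes X: "VF X" and Y: "VF Y" and \<alpha>: "\<alpha> \<in> {1..s}"
  shows "G (D X (\<xi> \<alpha>)) Y p = G X (F Y) p"
proof -
  note x = VF_xi[OF \<alpha>]
  \<comment> \<open>On test fields f Z, \<open>d_eta_D\<close> gives the skew part of the derivative
    of \<open>\<xi> \<alpha>\<close> and \<open>killing_F\<close> removes the symmetric part. With Z
    = f Y this settles horizontal test vectors; \<open>D_xi_xi\<close> settles the vertical
    ones.\<close>
  have *: "G (D X (\<xi> \<alpha>)) (F Z) p = G X (F (F Z)) p" if Z: "VF Z" for Z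
    using killing_F[OF X Z \<alpha>, of p] d_eta_D[OF X VF_F[OF Z] \<alpha>, of p] X Z x
    by (simp add: G_commute[of "F Z"])
  have "G (D X (\<xi> \<alpha>)) (F (F Y)) p = - G (D X (\<xi> \<alpha>)) Y p"
    using G_FF_left[OF Y VF_D[OF X x], of p] X Y x \<alpha>
    by (simp add: G_commute[of _ "D X _"] D_xi_xi)
  moreover have "G X (F (F (F Y))) p = - G X (F Y) p"
    using G_FF_left[OF VF_F[OF Y] X, of p] X Y by (simp add: G_commute[of X])
  ultimately show ?thesis using *[OF VF_F[OF Y]] by simp
qed

section \<open>The covariant derivative of f\<close>

text \<open>\<open>nablaF X Y Z = g((\<nabla>\<^sub>X f)Y, Z)\<close>, using that \<open>f\<close> is skew.\<close>

definition nablaF :: "'m vfield \<Rightarrow> 'm vfield \<Rightarrow> 'm vfield \<Rightarrow> 'm \<Rightarrow> real" where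
  "nablaF X Y Z p = G (D X (F Y)) Z p + G (D X Y) (F Z) p"

text \<open>The identity expressing skewness of f is differentiated along X.\<close>

lemma nablaF_skew:
  assumes "VF X" "VF Y" "VF Z"
  shows "nablaF X Z Y p = - nablaF X Y Z p"
proof -
  have "X p (\<lambda>q. - G (F Y) Z q) = - X p (G (F Y) Z)"
    using assms by (intro deriv_uminus) auto
  moreover have "G Y (F Z) = (\<lambda>q. - G (F Y) Z q)"
    using assms by (auto simp: G_F_right)
  ultimately show ?thesis
    using D_metric[of X "F Y" Z p] D_metric[of X Y "F Z" p] assms
    by (simp add: nablaF_def G_commute[of Y] G_commute[of "F Y"])
qed

text \<open>Closedness of \<Phi>, with brackets replaced by covariant derivatives through vanishing
  torsion.\<close>

lemma nablaF_cyclic: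
  assumes X: "VF X" and Y: "VF Y" and Z: "VF Z"
  shows "nablaF X Y Z p + nablaF Y Z X p + nablaF Z X Y p = 0"
proof -
  have 1: "X p (G Y (F Z)) = nablaF X Z Y p - G (D X Z) (F Y) p + G (D X Y) (F Z) p"
    if "VF X" "VF Y" "VF Z" for X Y Z
    using D_metric[of X Y "F Z" p] that by (simp add: nablaF_def G_commute[of Y])
  show ?thesis
    using d_Phi_eq_0[OF X Y Z, of p] 1[OF X Y Z] 1[OF Y Z X] 1[OF Z X Y]
      nablaF_skew[OF X Y Z, of p] nablaF_skew[OF Y Z X, of p] nablaF_skew[OF Z X Y, of p]
      D_torsion[OF X Y VF_F[OF Z], of p] D_torsion[OF Y Z VF_F[OF X], of p]
      D_torsion[OF Z X VF_F[OF Y], of p]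
    by linarith
qed

text \<open>Orthogonality is demanded at every point, since identities between horizontal fields get
  differentiated.\<close>

definition horizontal :: "'m vfield \<Rightarrow> bool" where
  "horizontal X \<longleftrightarrow> VF X \<and> (\<forall>\<alpha>\<in>{1..s}. \<forall>p. G X (\<xi> \<alpha>) p = 0)"

lemma horizontal_VF [simp]: "horizontal X \<Longrightarrow> VF X"
  by (simp add: horizontal_def)

lemma horizontal_F [simp]: "VF X \<Longrightarrow> horizontal (F X)"
  by (simp add: horizontal_def)

lemma horizontal_lincomb [simp]:
  "horizontal X \<Longrightarrow> horizontal Y \<Longrightarrow> horizontal (\<lambda>p h. a * X p h + b * Y p h)"
  by (simp add: horizontal_def G_lincomb_left)

lemma horizontal_G_xi: "horizontal X \<Longrightarrow> \<alpha> \<in> {1..s} \<Longrightarrow> G X (\<xi> \<alpha>) p = 0"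
  by (simp add: horizontal_def)

lemma horizontal_FF: "horizontal X \<Longrightarrow> VF Y \<Longrightarrow> G (F (F X)) Y p = - G X Y p"
  by (simp add: G_FF_left horizontal_G_xi)

lemma horizontal_FF_right: "horizontal X \<Longrightarrow> VF Y \<Longrightarrow> G Y (F (F X)) p = - G Y X p"
  by (simp add: G_commute[of Y] horizontal_FF)

lemma horizontal_F_F: "horizontal X \<Longrightarrow> VF Y \<Longrightarrow> G (F X) (F Y) p = G X Y p"
  by (simp add: G_F_F horizontal_G_xi)

text \<open>The relation V = a P + b Q is known only in tested form, so it is differentiated through
  metric compatibility.\<close>

lemma D_lincomb_G:
  assumes X: "VF X" and V: "VF V" "VF P" "VF Q" and W: "VF W"
    and eq: "\<And>W q. VF W \<Longrightarrow> G V W q = a * G P W q + b * G Q W q"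
  shows "G (D X V) W p = a * G (D X P) W p + b * G (D X Q) W p"
proof -
  have "G V W = (\<lambda>q. a * G P W q + b * G Q W q)"
    using eq[OF W] by auto
  then have "X p (G V W) = a * X p (G P W) + b * X p (G Q W)"
    using deriv_lincomb[of X "G P W" "G Q W" p a b] assms by simp
  then show ?thesis
    using D_metric[of X V W p] D_metric[of X P W p] D_metric[of X Q W p] eq[of "D X W" p] X V W
    by (simp add: algebra_simps)
qed

lemma D_FF:
  assumes "VF X" "horizontal Y" "VF W"
  shows "G (D X (F (F Y))) W p = - G (D X Y) W p"
  using D_lincomb_G[of X "F (F Y)" Y Y W "-1" 0 p] assms by (simp add: horizontal_FF)

text \<open>On horizontal fields f^2 = -I; its derivative says that f anticommutes with its
  covariant derivative.\<close>

lemma nablaF_F: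
  assumes "VF X" "horizontal Y" "horizontal Z"
  shows "nablaF X (F Y) Z p = nablaF X Y (F Z) p"
  using assms by (simp add: nablaF_def D_FF horizontal_FF_right)

text \<open>Normality with brackets expressed by the connection; the structure fields disappear
  against a horizontal Z.\<close>

lemma nablaF_normal:
  assumes X: "horizontal X" and Y: "horizontal Y" and Z: "horizontal Z"
  shows "nablaF (F X) Y Z p + nablaF X Y (F Z) p = nablaF (F Y) X Z p + nablaF Y X (F Z) p"
proof -
  note v = horizontal_VF[OF X] horizontal_VF[OF Y] horizontal_VF[OF Z]
  note d = D_torsion[where p=p]
  have "G (\<xi> \<alpha>) Z p = 0" if "\<alpha> \<in> {1..s}" for \<alpha>
    using horizontal_G_xi[OF Z that, of p] G_commute[OF VF_xi[OF that] v(3), of p] by simp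
  then have "- G (lie_bracket X Y) Z p + G (lie_bracket (F X) (F Y)) Z p
    + G (lie_bracket (F X) Y) (F Z) p + G (lie_bracket X (F Y)) (F Z) p = 0"
    using normality[OF v, of p] v Z
      G_F_right[of "lie_bracket (F X) Y" Z p] G_F_right[of "lie_bracket X (F Y)" Z p]
      G_F_right[of "F (lie_bracket X Y)" Z p] G_F_right[of "lie_bracket X Y" "F Z" p]
      horizontal_FF_right[OF Z, of "lie_bracket X Y" p]
    by simp
  then show ?thesis
    using d[of X Y Z] d[of "F X" "F Y" Z] d[of "F X" Y "F Z"] d[of X "F Y" "F Z"] v Z
    by (simp add: nablaF_def horizontal_FF_right)
qed

text \<open>As for a Kaehler structure: \<open>nablaF (F X) Y Z + nablaF X Y (F Z)\<close> is symmetric in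
  \<open>X, Y\<close> and skew in \<open>Y, Z\<close>, hence zero, and then the cyclic identity applies.\<close>

lemma nablaF_horizontal:
  assumes X: "horizontal X" and Y: "horizontal Y" and Z: "horizontal Z"
  shows "nablaF X Y Z p = 0"
proof -
  define a where "a X Y Z = nablaF (F X) Y Z p + nablaF X Y (F Z) p" for X Y Z
  have sym: "a X Y Z = a Y X Z" if "horizontal X" "horizontal Y" "horizontal Z" for X Y Z
    using nablaF_normal[OF that] by (simp add: a_def)
  have skew: "a X Z Y = - a X Y Z" if "horizontal X" "horizontal Y" "horizontal Z" for X Y Z
    using that nablaF_skew[of "F X" Y Z p] nablaF_skew[of X "F Y" Z p] nablaF_F[of X Y Z p]
    by (simp add: a_def)
  have 0: "nablaF (F X) Y Z p + nablaF X Y (F Z) p = 0"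
    if "horizontal X" "horizontal Y" "horizontal Z" for X Y Z
  proof -
    have "a X Y Z = - a X Y Z"
      using sym[of X Y Z] skew[of Y X Z] sym[of Y Z X] skew[of Z Y X] sym[of Z X Y] skew[of X Z Y] that
      by simp
    then show ?thesis by (simp add: a_def)
  qed
  have cyc: "nablaF X Y (F Z) p = 0" if h: "horizontal X" "horizontal Y" "horizontal Z" for X Y Z
  proof -
    note v = horizontal_VF[OF h(1)] horizontal_VF[OF h(2)] horizontal_VF[OF h(3)]
    have 1: "nablaF (F X) Y Z p + nablaF Y Z (F X) p + nablaF Z (F X) Y p = 0"
      if "VF X" "VF Y" "VF Z" for X Y Z
      using nablaF_cyclic[of "F X" Y Z p] that by simp
    \<comment> \<open>With T = \<open>nablaF X Y (F Z)\<close> and its cyclic shifts T', T'', the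
      identities become -T + T' + T'' = 0 and the two shifted equations, which force all three to be
      0.\<close>
    show ?thesis
      using 1[OF v] 1[OF v(2,3,1)] 1[OF v(3,1,2)] 0[OF h] 0[OF h(2,3,1)] 0[OF h(3,1,2)]
        nablaF_F[OF v(1) h(2,3), of p] nablaF_F[OF v(2) h(3,1), of p] nablaF_F[OF v(3) h(1,2), of p]
      by linarith
  qed
  have "nablaF X Y (F (F Z)) p = - nablaF X Y Z p"
    using assms by (simp add: nablaF_def horizontal_FF_right G_F_right[of _ "F (F Z)"] G_F_right[of _ "Z"])
  then show ?thesis using cyc[OF X Y, of "F Z"] Z by simp
qed

text \<open>V differs from - f (f V) by a combination of structure fields. The horizontal part
  contributes 0 by \<open>nablaF_horizontal\<close>; each structure field contributes g(X, Y) by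
  \<open>D_xi\<close>.\<close>

lemma nablaF_vertical:
  assumes X: "horizontal X" and Y: "horizontal Y" and V: "VF V"
  shows "nablaF X Y V p = (\<Sum>\<alpha>=1..s. G V (\<xi> \<alpha>) p) * G X Y p"
proof -
  note v = horizontal_VF[OF X] horizontal_VF[OF Y]
  have x: "G (D X (F Y)) (\<xi> \<alpha>) p = G X Y p" if \<alpha>: "\<alpha> \<in> {1..s}" for \<alpha>
  proof -
    have "G (F Y) (\<xi> \<alpha>) = (\<lambda>p. 0)" using \<alpha> v by auto
    then have "G (D X (F Y)) (\<xi> \<alpha>) p + G (D X (\<xi> \<alpha>)) (F Y) p = 0"
      using D_metric[of X "F Y" "\<xi> \<alpha>" p] v \<alpha> by (simp add: deriv_const G_commute[of "F Y"])
    then show ?thesis using D_xi[OF v(1) VF_F[OF v(2)] \<alpha>, of p] v Y by (simp add: horizontal_FF_right)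
  qed
  have 1: "G (D X (F Y)) (F (F V)) p = (\<Sum>\<alpha>=1..s. G V (\<xi> \<alpha>) p) * G X Y p - G (D X (F Y)) V p"
    using G_FF_left[OF V, of "D X (F Y)" p] v V
    by (simp add: G_commute[of _ "D X (F Y)"] x sum_distrib_right)
  have 2: "G (D X Y) (F (F (F V))) p = - G (D X Y) (F V) p"
    using V v by (simp add: horizontal_FF_right)
  have "nablaF X Y (F (F V)) p = 0"
    using nablaF_horizontal[OF X Y] V by simp
  then show ?thesis unfolding nablaF_def 1 2 by linarith
qed

text \<open>The cyclic identity moves U to the last slot, where the two contributions from
  \<open>nablaF_vertical\<close> cancel by symmetry of g.\<close>

lemma nablaF_first:
  assumes "VF U" "horizontal Z" "horizontal W"
  shows "nablaF U Z W p = 0"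
  using nablaF_cyclic[of U Z W p] nablaF_skew[of W U Z p] nablaF_vertical[of Z W U p]
    nablaF_vertical[of W Z U p] assms G_commute[of W Z p] by simp

section \<open>Curvature\<close>

definition Rm :: "'m vfield \<Rightarrow> 'm vfield \<Rightarrow> 'm vfield \<Rightarrow> 'm vfield \<Rightarrow> 'm \<Rightarrow> real" where
  "Rm = curvature4 g D"

lemma VF_curvature [simp]:
  assumes "VF X" "VF Y" "VF Z"
  shows "VF (curvature D X Y Z)"
  using VF_lincomb[of "\<lambda>p h. 1 * D X (D Y Z) p h + (-1) * D Y (D X Z) p h" "D (lie_bracket X Y) Z" 1 "-1"]
    VF_lincomb[of "D X (D Y Z)" "D Y (D X Z)" 1 "-1"] assms
  by (simp add: curvature_def)

lemma Rm_eq_G: "Rm X Y Z W p = G (curvature D X Y Z) W p"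
  by (simp add: Rm_def curvature4_def G_def)

lemma Rm_eq:
  assumes "VF X" "VF Y" "VF Z" "VF W"
  shows "Rm X Y Z W p = G (D X (D Y Z)) W p - G (D Y (D X Z)) W p - G (D (lie_bracket X Y) Z) W p"
proof -
  have "curvature D X Y Z = (\<lambda>p h. 1 * (1 * D X (D Y Z) p h + (-1) * D Y (D X Z) p h)
      + (-1) * D (lie_bracket X Y) Z p h)"
    by (simp add: curvature_def)
  then show ?thesis using assms
      G_lincomb_left[of "\<lambda>p h. 1 * D X (D Y Z) p h + (-1) * D Y (D X Z) p h" "D (lie_bracket X Y) Z" W 1 "-1" p]
      G_lincomb_left[of "D X (D Y Z)" "D Y (D X Z)" W 1 "-1" p]
      VF_lincomb[of "D X (D Y Z)" "D Y (D X Z)" 1 "-1"]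
    unfolding Rm_eq_G by simp
qed

lemma D_lincomb_left:
  assumes "VF X" "VF Y" "VF Z"
  shows "D (\<lambda>p j. a * X p j + b * Y p j) Z = (\<lambda>p j. a * D X Z p j + b * D Y Z p j)"
proof -
  have "\<forall>X Y Z h k. VF X \<longrightarrow> VF Y \<longrightarrow> VF Z \<longrightarrow> smooth_fun A h \<longrightarrow> smooth_fun A k \<longrightarrow>
      D (\<lambda>p j. h p * X p j + k p * Y p j) Z = (\<lambda>p j. h p * D X Z p j + k p * D Y Z p j)"
    using affine unfolding affine_connection_def by (elim conjE) assumption
  from this[rule_format, OF assms, of "\<lambda>_. a" "\<lambda>_. b"] show ?thesis
    by (simp add: smooth_fun_const)
qed

lemma D_bracket_swap:
  assumes "VF X" "VF Y" "VF Z" "VF W"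
  shows "G (D (lie_bracket Y X) Z) W p = - G (D (lie_bracket X Y) Z) W p"
proof -
  let ?B = "lie_bracket X Y"
  have "lie_bracket Y X = (\<lambda>p h. (-1) * ?B p h + 0 * ?B p h)"
    by (simp add: fun_eq_iff bracket_apply)
  moreover have "D (\<lambda>p h. (-1) * ?B p h + 0 * ?B p h) Z = (\<lambda>p j. (-1) * D ?B Z p j + 0 * D ?B Z p j)"
    using D_lincomb_left[OF VF_bracket VF_bracket, of X Y X Y Z "-1" 0] assms by simp
  ultimately have "D (lie_bracket Y X) Z = (\<lambda>p j. (-1) * D ?B Z p j + 0 * D ?B Z p j)"
    by simp
  then show ?thesis
    using G_lincomb_left[of "D ?B Z" "D ?B Z" W "-1" 0 p] assms by simp
qed

section \<open>Algebraic symmetries of the curvature tensor\<close>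

lemma Rm_skew12:
  assumes "VF X" "VF Y" "VF Z" "VF W"
  shows "Rm Y X Z W p = - Rm X Y Z W p"
  using assms by (simp add: Rm_eq D_bracket_swap[of X Y])

text \<open>The bracket of X and Y acts on the function g(Z, W) as the commutator of X and Y;
  expanding by metric compatibility, the mixed terms are symmetric in X, Y and cancel.\<close>

lemma Rm_skew34:
  assumes v: "VF X" "VF Y" "VF Z" "VF W"
  shows "Rm X Y W Z p = - Rm X Y Z W p"
proof -
  have *: "X p (\<lambda>q. Y q (G Z W)) = G (D X (D Y Z)) W p + G (D Y Z) (D X W) p
    + (G (D X Z) (D Y W) p + G Z (D X (D Y W)) p)" if "VF X" "VF Y" for X Y
  proof -
    have "(\<lambda>q. Y q (G Z W)) = (\<lambda>q. 1 * G (D Y Z) W q + 1 * G Z (D Y W) q)"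
      using D_metric that v by simp
    then have "X p (\<lambda>q. Y q (G Z W)) = X p (G (D Y Z) W) + X p (G Z (D Y W))"
      using deriv_lincomb[of X "G (D Y Z) W" "G Z (D Y W)" p 1 1] that v by simp
    then show ?thesis
      using D_metric[of X "D Y Z" W p] D_metric[of X Z "D Y W" p] that v by simp
  qed
  have "lie_bracket X Y p (G Z W) = X p (\<lambda>q. Y q (G Z W)) - Y p (\<lambda>q. X q (G Z W))"
    by (simp add: bracket_apply)
  then show ?thesis
    using *[OF v(1,2)] *[OF v(2,1)] D_metric[of "lie_bracket X Y" Z W p] v
    by (simp add: Rm_eq G_commute[of Z])
qed

text \<open>Vanishing torsion, used twice, turns the cyclic sum into double brackets, and the Jacobi
  identity applies.\<close>

lemma Rm_bianchi:
  assumes v: "VF X" "VF Y" "VF Z" "VF W"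
  shows "Rm X Y Z W p + Rm Y Z X W p + Rm Z X Y W p = 0"
proof -
  have *: "G (D X (D Y Z)) W p - G (D X (D Z Y)) W p - G (D (lie_bracket Y Z) X) W p =
      G (lie_bracket X (lie_bracket Y Z)) W p"
    if "VF X" "VF Y" "VF Z" for X Y Z
    using D_lincomb_G[of X "lie_bracket Y Z" "D Y Z" "D Z Y" W 1 "-1" p]
      D_torsion[of X "lie_bracket Y Z" W p] D_torsion[of Y Z] that v by simp
  have s: "G (lie_bracket V U) W p = - G (lie_bracket U V) W p" if "VF U" "VF V" for U V
    using D_torsion[of U V W p] D_torsion[of V U W p] that v by simp
  show ?thesis
    using *[OF v(1,2,3)] *[OF v(2,3,1)] *[OF v(3,1,2)] jacobi[OF v, of p]
      s[of "lie_bracket X Y" Z] s[of "lie_bracket Y Z" X] s[of "lie_bracket Z X" Y] v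
    by (simp add: Rm_eq)
qed

text \<open>The usual combination of four cyclic identities with the two skew symmetries.\<close>

lemma Rm_pair:
  assumes v: "VF X" "VF Y" "VF Z" "VF W"
  shows "Rm Z W X Y p = Rm X Y Z W p"
  using Rm_bianchi[OF v(1,2,3,4), of p] Rm_bianchi[OF v(2,3,4,1), of p]
    Rm_bianchi[OF v(3,4,1,2), of p] Rm_bianchi[OF v(4,1,2,3), of p]
    Rm_skew34[OF v(2,3,1,4), of p] Rm_skew34[OF v(3,4,1,2), of p]
    Rm_skew12[OF v(3,1,4,2), of p] Rm_skew34[OF v(3,1,2,4), of p]
    Rm_skew34[OF v(4,1,3,2), of p] Rm_skew34[OF v(1,2,3,4), of p]
    Rm_skew12[OF v(4,2,1,3), of p] Rm_skew34[OF v(4,2,3,1), of p]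
  by linarith

lemma Rm_lincomb4:
  assumes "VF X" "VF Y" "VF Z" "VF V" "VF W"
  shows "Rm X Y Z (\<lambda>p h. a * V p h + b * W p h) p = a * Rm X Y Z V p + b * Rm X Y Z W p"
  using assms by (simp add: Rm_eq_G G_lincomb_right)

text \<open>The formula for the derivative of f is differentiated once more. The factor
  \<open>s\<close> arises in \<open>sum_xi\<close>, where each of the \<open>s\<close> structure
  fields contributes the same amount. The tensor of constant curvature \<open>s\<close> satisfies
  the same relation.\<close>

lemma Rm_F:
  assumes X: "horizontal X" and Y: "horizontal Y" and Z: "horizontal Z" and W: "horizontal W"
  shows "Rm X Y (F Z) W p + Rm X Y Z (F W) p =
    real s * (G Y (F Z) p * G X W p - G X (F Z) p * G Y W p
      + G Y Z p * G X (F W) p - G X Z p * G Y (F W) p)"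
proof -
  note v = horizontal_VF[OF X] horizontal_VF[OF Y] horizontal_VF[OF Z] horizontal_VF[OF W]
  have sum_xi: "(\<Sum>\<alpha>=1..s. G (D Y Z) (\<xi> \<alpha>) p) = - real s * G Y (F Z) p"
    if Y: "horizontal Y" and Z: "horizontal Z" for Y Z
  proof -
    have "G (D Y Z) (\<xi> \<alpha>) p = - G Y (F Z) p" if \<alpha>: "\<alpha> \<in> {1..s}" for \<alpha>
    proof -
      have "G Z (\<xi> \<alpha>) = (\<lambda>p. 0)" using \<alpha> Z by (auto simp: horizontal_G_xi)
      then show ?thesis
        using D_metric[of Y Z "\<xi> \<alpha>" p] D_xi[of Y Z \<alpha> p] Y Z \<alpha> by (simp add: deriv_const G_commute[of Z])
    qed
    then show ?thesis by simp
  qed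
  have 2: "G (D X (D Y (F Z))) W p + G (D X (D Y Z)) (F W) p =
      real s * (G Y (F Z) p * G X W p + G X (F W) p * G Y Z p)"
    if X: "horizontal X" and Y: "horizontal Y" for X Y
  proof -
    note v' = horizontal_VF[OF X] horizontal_VF[OF Y]
    \<comment> \<open>\<open>nablaF_horizontal\<close> holds at every point, so the equality of
      functions can be differentiated along X.\<close>
    have "G (D Y (F Z)) W = (\<lambda>q. - G (D Y Z) (F W) q)"
      using nablaF_horizontal[OF Y Z W] by (auto simp: nablaF_def fun_eq_iff eq_neg_iff_add_eq_0)
    then have "X p (G (D Y (F Z)) W) = - X p (G (D Y Z) (F W))"
      using deriv_uminus[of X "G (D Y Z) (F W)" p] v v' by simp
    then have "G (D X (D Y (F Z))) W p + G (D Y (F Z)) (D X W) p =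
        - G (D X (D Y Z)) (F W) p - G (D Y Z) (D X (F W)) p"
      using D_metric[of X "D Y (F Z)" W p] D_metric[of X "D Y Z" "F W" p] v v' by simp
    \<comment> \<open>The derivative of W along X need not be horizontal; its vertical part enters
      through \<open>nablaF_vertical\<close>.\<close>
    moreover have "G (D Y (F Z)) (D X W) p + G (D Y Z) (F (D X W)) p =
        - real s * G X (F W) p * G Y Z p"
      using nablaF_vertical[OF Y Z VF_D[OF v'(1) v(4)], of p] sum_xi[OF X W] by (simp add: nablaF_def)
    moreover have "G (D X (F W)) (D Y Z) p + G (D X W) (F (D Y Z)) p =
        - real s * G Y (F Z) p * G X W p"
      using nablaF_vertical[OF X W VF_D[OF v'(2) v(3)], of p] sum_xi[OF Y Z] by (simp add: nablaF_def)
    ultimately show ?thesis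
      using v v' G_commute[of "D Y Z" "D X (F W)" p] G_F_right[of "D X W" "D Y Z" p]
        G_commute[of "F (D X W)" "D Y Z" p]
      by (simp add: algebra_simps)
  qed
  \<comment> \<open>The bracket may have a vertical part, hence \<open>nablaF_first\<close>.\<close>
  have "G (D (lie_bracket X Y) (F Z)) W p + G (D (lie_bracket X Y) Z) (F W) p = 0"
    using nablaF_first[of "lie_bracket X Y" Z W p] v Z W by (simp add: nablaF_def)
  then show ?thesis
    using 2[OF X Y] 2[OF Y X] v by (simp add: Rm_eq algebra_simps)
qed

text \<open>The curvature tensor minus that of a space of constant curvature \<open>s\<close>.  On horizontal
  fields it has the symmetries of a Kaehler curvature tensor.\<close>

definition kRm :: "'m vfield \<Rightarrow> 'm vfield \<Rightarrow> 'm vfield \<Rightarrow> 'm vfield \<Rightarrow> 'm \<Rightarrow> real" where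
  "kRm X Y Z W p = Rm X Y Z W p - real s * (G Y Z p * G X W p - G X Z p * G Y W p)"

section \<open>Kaehler-type symmetries of \<open>kRm\<close>\<close>

lemma kRm_skew12: "VF X \<Longrightarrow> VF Y \<Longrightarrow> VF Z \<Longrightarrow> VF W \<Longrightarrow> kRm Y X Z W p = - kRm X Y Z W p"
  using Rm_skew12[of X Y Z W p] by (simp add: kRm_def algebra_simps)

lemma kRm_skew34: "VF X \<Longrightarrow> VF Y \<Longrightarrow> VF Z \<Longrightarrow> VF W \<Longrightarrow> kRm X Y W Z p = - kRm X Y Z W p"
  using Rm_skew34[of X Y Z W p] by (simp add: kRm_def algebra_simps)

lemma kRm_pair: "VF X \<Longrightarrow> VF Y \<Longrightarrow> VF Z \<Longrightarrow> VF W \<Longrightarrow> kRm Z W X Y p = kRm X Y Z W p"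
  using Rm_pair[of X Y Z W p] G_commute[of W X p] G_commute[of Z Y p] G_commute[of Z X p]
    G_commute[of W Y p] by (simp add: kRm_def algebra_simps)

lemma kRm_bianchi:
  "VF X \<Longrightarrow> VF Y \<Longrightarrow> VF Z \<Longrightarrow> VF W \<Longrightarrow> kRm X Y Z W p + kRm Y Z X W p + kRm Z X Y W p = 0"
  using Rm_bianchi[of X Y Z W p] G_commute[of Y X p] G_commute[of Z Y p] G_commute[of Z X p]
  by (simp add: kRm_def algebra_simps)

lemma kRm_F:
  assumes "horizontal X" "horizontal Y" "horizontal Z" "horizontal W"
  shows "kRm X Y (F Z) W p + kRm X Y Z (F W) p = 0"
  using Rm_F[OF assms, of p] by (simp add: kRm_def algebra_simps)

lemma kRm_lincomb4:
  assumes "VF X" "VF Y" "VF Z" "VF V" "VF W"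
  shows "kRm X Y Z (\<lambda>p h. a * V p h + b * W p h) p = a * kRm X Y Z V p + b * kRm X Y Z W p"
  using assms by (simp add: kRm_def Rm_lincomb4 G_lincomb_right algebra_simps)

text \<open>Linearity in the last slot comes from the metric; the symmetries carry it to this and
  the other slots.\<close>

lemma kRm_lincomb3:
  assumes "VF X" "VF Y" "VF Z" "VF V" "VF W"
  shows "kRm X Y (\<lambda>p h. a * V p h + b * W p h) Z p = a * kRm X Y V Z p + b * kRm X Y W Z p"
  using assms by (simp add: kRm_skew34[of X Y Z] kRm_lincomb4)

lemma kRm_lincomb1:
  assumes "VF X" "VF Y" "VF Z" "VF V" "VF W"
  shows "kRm (\<lambda>p h. a * V p h + b * W p h) X Y Z p = a * kRm V X Y Z p + b * kRm W X Y Z p"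
  using assms by (simp add: kRm_pair[of Y Z _ X] kRm_lincomb3)

lemma kRm_lincomb2:
  assumes "VF X" "VF Y" "VF Z" "VF V" "VF W"
  shows "kRm X (\<lambda>p h. a * V p h + b * W p h) Y Z p = a * kRm X V Y Z p + b * kRm X W Y Z p"
  using assms by (simp add: kRm_pair[of Y Z X] kRm_lincomb4)

lemma kRm_FF4:
  "VF X \<Longrightarrow> VF Y \<Longrightarrow> VF Z \<Longrightarrow> horizontal W \<Longrightarrow> kRm X Y Z (F (F W)) p = - kRm X Y Z W p"
  by (simp add: kRm_def Rm_eq_G horizontal_FF_right algebra_simps)

lemma kRm_F_F:
  assumes "horizontal X" "horizontal Y" "horizontal Z" "horizontal W"
  shows "kRm X Y (F Z) (F W) p = kRm X Y Z W p"
  using kRm_F[of X Y Z "F W" p] assms by (simp add: kRm_FF4)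

text \<open>The cyclic identity for X, f X, f Y; invariance under f turns the other two terms into
  sectional values.\<close>

lemma kRm_polarized_bianchi:
  assumes h: "horizontal X" "horizontal Y"
  shows "kRm X (F X) (F Y) Y p = kRm X Y Y X p + kRm X (F Y) (F Y) X p"
proof -
  note v = horizontal_VF[OF h(1)] horizontal_VF[OF h(2)]
  note w = v VF_F[OF v(1)] VF_F[OF v(2)]
  have "kRm (F X) (F Y) X Y p = - kRm X Y Y X p"
    using kRm_pair[OF w(1,2,3,4), of p] kRm_F_F[OF h h, of p] kRm_skew34[OF w(1,2,2,1), of p] by simp
  moreover have "kRm (F Y) X (F X) Y p = - kRm X (F Y) (F Y) X p"
    using kRm_skew12[OF w(1,4,3,2), of p] kRm_F[of X "F Y" X Y p] kRm_skew34[OF w(1,4,4,1), of p] h w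
    by simp
  ultimately show ?thesis using kRm_bianchi[OF w(1,3,4,2), of p] by simp
qed

text \<open>Cauchy-Schwarz: the part of X orthogonal to Y has nonnegative square norm.\<close>

lemma G_bound:
  assumes "VF X" "VF Y" "G X X p = 1" "G Y Y p = 1"
  shows "\<bar>G X Y p\<bar> \<le> 1"
proof -
  define U where "U = (\<lambda>q h. 1 * X q h + (- G X Y p) * Y q h)"
  have U: "VF U" unfolding U_def using assms by (intro VF_lincomb)
  have "G U V p = G X V p - G X Y p * G Y V p" if "VF V" for V
    using G_lincomb_left[OF assms(1,2) that, of 1 "- G X Y p" p] by (simp add: U_def)
  then have "G U U p = 1 - (G X Y p)\<^sup>2"
    using assms U G_commute[of X U p] G_commute[of Y U p] G_commute[of Y X p]
    by (simp add: power2_eq_square)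
  then show ?thesis using G_nonneg[OF U, of p] by (simp add: abs_square_le_1[symmetric])
qed

section \<open>Existence of sufficiently many fields\<close>

text \<open>The formal combination with coefficients \<open>a\<close> is invisible to each 1-form of
  the structure and to \<Phi>, hence to every factor of the volume form. The arguments are thus
  linearly dependent as far as this form can tell.\<close>

lemma eta_volume_form_eq_0:
  assumes x: "\<And>i. i < 2 * n + s \<Longrightarrow> VF (x i)" and \<alpha>: "\<alpha> \<in> {1..s}"
    and i: "i < 2 * n + s" "a i \<noteq> 0"
    and xi: "\<And>\<beta>. \<beta> \<in> {1..s} \<Longrightarrow> (\<Sum>j<2 * n + s. a j * G (x j) (\<xi> \<beta>) p) = 0"
    and F: "\<And>W. VF W \<Longrightarrow> (\<Sum>j<2 * n + s. a j * G (x j) (F W) p) = 0"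
  shows "eta_volume_form n s \<eta> \<alpha> p x = 0"
proof -
  have 1: "annihilated (Collect VF) (s + 2 * n) a x 1 (\<lambda>X. \<eta> \<beta> p (X 0 p))" if "\<beta> \<in> {1..s}" for \<beta>
  proof -
    have "(\<Sum>j<s + 2 * n. a j * \<eta> \<beta> p (x j p)) = (\<Sum>j<2 * n + s. a j * G (x j) (\<xi> \<beta>) p)"
      using x that by (intro sum.cong) (auto simp: eta_eq_G)
    then show ?thesis using xi[OF that] by (auto simp: annihilated_def)
  qed
  have 2: "annihilated (Collect VF) (s + 2 * n) a x 2 (\<lambda>X. ext_deriv (\<eta> \<alpha>) (X 0) (X 1) p)"
  proof -
    note e = ext_deriv_eq_G[OF _ _ \<alpha>]
    have "(\<Sum>j<s + 2 * n. a j * ext_deriv (\<eta> \<alpha>) (x j) W p) = 0" if "VF W" for W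
    proof -
      have "(\<Sum>j<s + 2 * n. a j * ext_deriv (\<eta> \<alpha>) (x j) W p) = (\<Sum>j<2 * n + s. a j * G (x j) (F W) p)"
        using x that by (intro sum.cong) (auto simp: e)
      then show ?thesis using F[OF that] by simp
    qed
    moreover have "(\<Sum>j<s + 2 * n. a j * ext_deriv (\<eta> \<alpha>) W (x j) p) = 0" if "VF W" for W
    proof -
      have "(\<Sum>j<s + 2 * n. a j * ext_deriv (\<eta> \<alpha>) W (x j) p) = (\<Sum>j<2 * n + s. - (a j * G (x j) (F W) p))"
        using x that by (intro sum.cong) (auto simp: e G_F_right[of W] G_commute[of "F W"])
      then show ?thesis using F[OF that] by (simp add: sum_negf)
    qed
    ultimately show ?thesis by (auto simp: annihilated_def less_2_cases_iff)
  qed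
  have "annihilated (Collect VF) (s + 2 * n) a x s (wedge_upto 1 (\<lambda>\<beta> X. \<eta> \<beta> p (X 0 p)) s)"
    using annihilated_wedge_upto[of s "Collect VF" "s + 2 * n" a x 1 "\<lambda>\<beta> X. \<eta> \<beta> p (X 0 p)"] 1 by simp
  moreover have "annihilated (Collect VF) (s + 2 * n) a x (2 * n)
      (wedge_upto 2 (\<lambda>_ X. ext_deriv (\<eta> \<alpha>) (X 0) (X 1) p) n)"
    using annihilated_wedge_upto[of n "Collect VF" "s + 2 * n" a x 2
        "\<lambda>_ X. ext_deriv (\<eta> \<alpha>) (X 0) (X 1) p"] 2 by (simp add: mult.commute)
  ultimately have "annihilated (Collect VF) (s + 2 * n) a x (s + 2 * n)
      (wedge s (2 * n) (wedge_upto 1 (\<lambda>\<beta> X. \<eta> \<beta> p (X 0 p)) s)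
         (wedge_upto 2 (\<lambda>_ X. ext_deriv (\<eta> \<alpha>) (X 0) (X 1) p) n))"
    by (rule annihilated_wedge)
  from wedge_dependent_args[OF this] show ?thesis
    using x i unfolding eta_volume_form_def by (simp add: add.commute)
qed

text \<open>Rescaling by a constant keeps the field horizontal everywhere; it becomes a unit field
  at \<open>p\<close> only.\<close>

lemma normalize:
  assumes "horizontal W" "W p \<noteq> (\<lambda>_. 0)"
  obtains U a where "horizontal U" "G U U p = 1" "\<And>Z. VF Z \<Longrightarrow> G U Z p = a * G W Z p"
proof -
  define a where "a = 1 / sqrt (G W W p)"
  define U where "U = (\<lambda>p h. a * W p h + 0 * W p h)"
  note w = horizontal_VF[OF assms(1)]
  have U: "horizontal U" unfolding U_def using assms by (intro horizontal_lincomb)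
  have G: "G U Z p = a * G W Z p" if "VF Z" for Z
    using G_lincomb_left[OF w w that, of a 0 p] by (simp add: U_def)
  have "G U U p = a * a * G W W p"
    using G[of U] G[OF w] U G_commute[OF w, of U p] by simp
  then have "G U U p = 1" using G_pos[OF w assms(2)] by (simp add: a_def)
  then show ?thesis using that U G by blast
qed

text \<open>The volume form vanishes on fields whose values at \<open>p\<close> lie in the span of
  \<open>\<xi> 1, \<dots>, \<xi> s, u, f u\<close>, since \<open>s + 2 < 2 * n + s\<close>.\<close>

lemma horizontal_complement:
  assumes n: "2 \<le> n" and u: "VF u"
  shows "\<exists>X. VF X \<and> (\<lambda>h. - F (F X) p h - G X u p * u p h - G X (F u) p * F u p h) \<noteq> (\<lambda>_. 0)"
proof (rule ccontr)
  assume neg: "\<not> ?thesis"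
  have 1: "1 \<in> {1..s}" using s_pos by simp
  obtain x where x: "\<And>i. i < 2 * n + s \<Longrightarrow> VF (x i)" and vol: "eta_volume_form n s \<eta> 1 p x \<noteq> 0"
    using S_manifold 1 unfolding S_manifold_def by metis
  \<comment> \<open>The coefficients of \<open>s + 2\<close> equations: columns 0 to s - 1 belong to
    \<xi> 1 to \<xi> s, column s to u and column s + 1 to f u.\<close>
  define c where "c i j = (if j < s then G (x i) (\<xi> (Suc j)) p else if j = s then G (x i) u p
    else G (x i) (F u) p)" for i j
  have "s + 2 < card {..<2 * n + s}" using n by simp
  from homogeneous_system_nontrivial[OF _ this, of c]
  obtain a where a: "\<exists>i<2 * n + s. a i \<noteq> 0" "\<And>j. j < s + 2 \<Longrightarrow> (\<Sum>i<2 * n + s. a i * c i j) = 0"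
    by auto
  have "(\<Sum>i<2 * n + s. a i * G (x i) (F W) p) = 0" if W: "VF W" for W
  proof -
    have "G (x i) (F W) p = c i s * G u (F W) p + c i (Suc s) * G (F u) (F W) p" if "i < 2 * n + s" for i
    proof -
      \<comment> \<open>The horizontal part of \<open>x i\<close> minus its components along u and f
        u; \<open>neg\<close> makes it vanish at \<open>p\<close>.\<close>
      define V where "V = (\<lambda>q h. (-1) * F (F (x i)) q h
        + 1 * ((- G (x i) u p) * u q h + (- G (x i) (F u) p) * F u q h))"
      have "V p = (\<lambda>h. - F (F (x i)) p h - G (x i) u p * u p h - G (x i) (F u) p * F u p h)"
        by (simp add: V_def fun_eq_iff)
      then have "V p = (\<lambda>_. 0)" using neg x[OF that] by metis
      then have "0 = G V (F W) p" using W by (simp add: G_zero_left)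
      also have "\<dots> = (-1) * G (F (F (x i))) (F W) p +
          1 * ((- G (x i) u p) * G u (F W) p + (- G (x i) (F u) p) * G (F u) (F W) p)"
        unfolding V_def using x[OF that] W u
        by (simp only: G_lincomb_left VF_F VF_lincomb)
      finally show ?thesis using x[OF that] W G_FF_left[of "x i" "F W" p] by (simp add: c_def)
    qed
    then have "(\<Sum>i<2 * n + s. a i * G (x i) (F W) p) =
        (\<Sum>i<2 * n + s. a i * c i s * G u (F W) p + a i * c i (Suc s) * G (F u) (F W) p)"
      by (intro sum.cong) (auto simp: algebra_simps)
    also have "\<dots> = (\<Sum>i<2 * n + s. a i * c i s) * G u (F W) p + (\<Sum>i<2 * n + s. a i * c i (Suc s)) * G (F u) (F W) p"
      by (simp only: sum.distrib sum_distrib_right)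
    finally show ?thesis using a(2)[of s] a(2)[of "Suc s"] by simp
  qed
  moreover have "(\<Sum>i<2 * n + s. a i * G (x i) (\<xi> \<beta>) p) = 0" if "\<beta> \<in> {1..s}" for \<beta>
  proof -
    have "\<beta> - 1 < s" "Suc (\<beta> - 1) = \<beta>" using that by auto
    then show ?thesis using a(2)[of "\<beta> - 1"] by (simp only: c_def if_True)
  qed
  moreover obtain i where "i < 2 * n + s" "a i \<noteq> 0" using a(1) by blast
  ultimately have "eta_volume_form n s \<eta> 1 p x = 0"
    using x 1 by (intro eta_volume_form_eq_0[of x 1 i a p]) auto
  with vol show False ..
qed

text \<open>Gram-Schmidt: a unit horizontal u is chosen first, then a unit horizontal vector
  orthogonal to both u and f u.\<close>

lemma exists_orthonormal_F_orthogonal: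
  assumes n: "2 \<le> n"
  obtains X Y where "horizontal X" "horizontal Y" "G X X p = 1" "G Y Y p = 1"
    "G X Y p = 0" "G X (F Y) p = 0"
proof -
  \<comment> \<open>With u = 0 the complement is just a nonzero horizontal vector.\<close>
  obtain X where X: "VF X" "(\<lambda>h. - F (F X) p h) \<noteq> (\<lambda>_. 0)"
    using horizontal_complement[OF n VF_zero, of p] by auto
  then have "F (F X) p \<noteq> (\<lambda>_. 0)" by auto
  then obtain u where u: "horizontal u" "G u u p = 1"
    using normalize[OF horizontal_F[OF VF_F[OF X(1)]]] by metis
  note vu = horizontal_VF[OF u(1)]
  obtain Y where Y: "VF Y"
    "(\<lambda>h. - F (F Y) p h - G Y u p * u p h - G Y (F u) p * F u p h) \<noteq> (\<lambda>_. 0)"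
    using horizontal_complement[OF n vu, of p] by auto
  define V where "V = (\<lambda>q h. (-1) * F (F Y) q h
        + 1 * ((- G Y u p) * u q h + (- G Y (F u) p) * F u q h))"
  have V: "horizontal V" unfolding V_def using Y(1) u by (intro horizontal_lincomb) auto
  have "V p = (\<lambda>h. - F (F Y) p h - G Y u p * u p h - G Y (F u) p * F u p h)"
    by (simp add: V_def fun_eq_iff)
  with Y(2) have "V p \<noteq> (\<lambda>_. 0)" by (simp only: not_False_eq_True)
  then obtain U b where U: "horizontal U" "G U U p = 1" "\<And>Z. VF Z \<Longrightarrow> G U Z p = b * G V Z p"
    using normalize[OF V] by metis
  have G: "G V Z p = - G (F (F Y)) Z p - G Y u p * G u Z p - G Y (F u) p * G (F u) Z p" if "VF Z" for Z
  proof -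
    have "G V Z p = (-1) * G (F (F Y)) Z p +
          1 * ((- G Y u p) * G u Z p + (- G Y (F u) p) * G (F u) Z p)"
      unfolding V_def using Y(1) that vu by (simp only: G_lincomb_left VF_F VF_lincomb)
    then show ?thesis by simp
  qed
  have "G V u p = 0"
    using G[OF vu] u Y(1) vu G_FF_left[OF Y(1) vu, of p] G_F_self[OF vu, of p] G_commute[of "F u" u p]
    by (simp add: horizontal_G_xi)
  moreover have "G V (F u) p = 0"
    using G[of "F u"] u Y(1) vu G_FF_left[OF Y(1), of "F u" p] G_F_self[OF vu, of p]
    by (simp add: horizontal_F_F)
  ultimately show ?thesis using that[OF U(1) u(1) U(2) u(2)] U(3) vu by simp
qed

end

section \<open>S-space-forms\<close>

locale s_space_form = s_manifold +
  fixes c :: real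
  assumes f_sectional: "constant_f_sectional_curvature s A f \<xi> g D c"
begin

lemma Rm_f_sectional:
  assumes "horizontal X" "G X X p = 1"
  shows "Rm X (F X) (F X) X p = c"
proof -
  have "X p \<in> L_space s A \<xi> g p"
    using assms(1) by (simp add: L_space_def horizontal_def G_def)
  then show ?thesis
    using f_sectional assms unfolding constant_f_sectional_curvature_def Rm_def sectional_curvature_def
    by (simp add: G_def)
qed

text \<open>Homogeneity of degree four extends the hypothesis on unit fields to the combinations X +
  t Y used in polarization.\<close>

lemma kRm_f_sectional:
  assumes X: "horizontal X" and pos: "G X X p > 0"
  shows "kRm X (F X) (F X) X p = (c - s) * (G X X p)\<^sup>2"
proof -
  define a where "a = 1 / sqrt (G X X p)"
  have a2: "a * a * G X X p = 1" using pos by (simp add: a_def)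
  define U where "U = (\<lambda>p h. a * X p h + 0 * X p h)"
  have U: "horizontal U" unfolding U_def using X by (intro horizontal_lincomb)
  have v: "VF X" "VF U" using X U by auto
  have GU: "G U Y q = a * G X Y q" if "VF Y" for Y q
    using G_lincomb_left[OF v(1,1) that, of a 0 q] by (simp add: U_def)
  have FU: "F U = (\<lambda>p h. a * F X p h + 0 * F X p h)"
    using F_lincomb[OF v(1,1), of a 0] by (simp add: U_def)
  have 1: "G U U p = 1"
    using GU[OF v(2)] GU[OF v(1)] a2 G_commute[OF v, of p] by simp
  have "kRm U (F U) (F U) U p = a * (a * (a * (a * kRm X (F X) (F X) X p)))"
    unfolding FU unfolding U_def using v
    by (simp only: kRm_lincomb1 kRm_lincomb2 kRm_lincomb3 kRm_lincomb4 VF_F VF_lincomb) simp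
  moreover have "kRm U (F U) (F U) U p = c - s"
    using Rm_f_sectional[OF U 1] 1 U v G_F_self[OF v(2), of p] G_commute[of "F U" U p]
    by (simp add: kRm_def horizontal_F_F)
  ultimately have "(a * a * G X X p)\<^sup>2 * kRm X (F X) (F X) X p = (c - s) * (G X X p)\<^sup>2"
    by (simp add: power2_eq_square algebra_simps)
  then show ?thesis using a2 by simp
qed

text \<open>The holomorphic value at X + t Y is a quartic in t. Its t^2 coefficient is isolated, and
  the symmetries of \<open>kRm\<close> rewrite it as twice the left side.\<close>

lemma kRm_polarized:
  assumes h: "horizontal X" "horizontal Y" and u: "G X X p = 1" "G Y Y p = 1"
  shows "kRm X Y Y X p + 3 * kRm X (F Y) (F Y) X p = (c - s) * (1 + 2 * (G X Y p)\<^sup>2)"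
proof -
  note v = horizontal_VF[OF h(1)] horizontal_VF[OF h(2)]
  note w = v VF_F[OF v(1)] VF_F[OF v(2)]
  have b: "\<bar>G X Y p\<bar> \<le> 1" using G_bound[OF v u] .
  \<comment> \<open>The values 2 and -2 keep 1 + 2 t g(X, Y) + t^2 positive whenever |g(X, Y)| is at
    most 1; with 1 and -1 it could be 0.\<close>
  have *: "kRm (\<lambda>p h. 1 * X p h + t * Y p h) (\<lambda>p h. 1 * F X p h + t * F Y p h)
      (\<lambda>p h. 1 * F X p h + t * F Y p h) (\<lambda>p h. 1 * X p h + t * Y p h) p =
      (c - s) * (1 + 2 * t * G X Y p + t\<^sup>2)\<^sup>2" if t: "t = 2 \<or> t = -2" for t
  proof -
    let ?U = "\<lambda>p h. 1 * X p h + t * Y p h"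
    have U: "horizontal ?U" using h by (intro horizontal_lincomb)
    have G: "G ?U ?U p = 1 + 2 * t * G X Y p + t\<^sup>2"
      using G_lincomb_left[OF v horizontal_VF[OF U], of 1 t p] u G_commute[OF v, of p]
        G_lincomb_right[OF v v(1), of 1 t p] G_lincomb_right[OF v v(2), of 1 t p]
      by (simp add: power2_eq_square algebra_simps)
    have "0 < 1 + 2 * t * G X Y p + t\<^sup>2" using t b by auto
    then show ?thesis
      using kRm_f_sectional[OF U] F_lincomb[OF v, of 1 t] by (simp only: G)
  qed
  have "kRm (\<lambda>p h. 1 * X p h + t * Y p h) (\<lambda>p h. 1 * F X p h + t * F Y p h)
      (\<lambda>p h. 1 * F X p h + t * F Y p h) (\<lambda>p h. 1 * X p h + t * Y p h) p =
      kRm X (F X) (F X) X p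
      + t * (kRm Y (F X) (F X) X p + kRm X (F Y) (F X) X p + kRm X (F X) (F Y) X p + kRm X (F X) (F X) Y p)
      + t\<^sup>2 * (kRm Y (F Y) (F X) X p + kRm X (F X) (F Y) Y p + kRm Y (F X) (F Y) X p
         + kRm X (F Y) (F X) Y p + kRm Y (F X) (F X) Y p + kRm X (F Y) (F Y) X p)
      + t^3 * (kRm X (F Y) (F Y) Y p + kRm Y (F X) (F Y) Y p + kRm Y (F Y) (F X) Y p + kRm Y (F Y) (F Y) X p)
      + t^4 * kRm Y (F Y) (F Y) Y p" for t
    using w
    by (simp only: kRm_lincomb1 kRm_lincomb2 kRm_lincomb3 kRm_lincomb4 VF_lincomb)
      (simp add: algebra_simps power2_eq_square power3_eq_cube power4_eq_xxxx)
  \<comment> \<open>Adding the two instances removes the odd powers of t.\<close>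
  from *[of 2, unfolded this] *[of "-2", unfolded this]
  have "2 * kRm X (F X) (F X) X p + 8 * (kRm Y (F Y) (F X) X p + kRm X (F X) (F Y) Y p
      + kRm Y (F X) (F Y) X p + kRm X (F Y) (F X) Y p + kRm Y (F X) (F X) Y p + kRm X (F Y) (F Y) X p)
      + 32 * kRm Y (F Y) (F Y) Y p = (c - s) * ((5 + 4 * G X Y p)\<^sup>2 + (5 - 4 * G X Y p)\<^sup>2)"
    by (simp add: algebra_simps)
  moreover have "kRm X (F X) (F X) X p = c - s" "kRm Y (F Y) (F Y) Y p = c - s"
    using kRm_f_sectional h u by simp_all
  moreover have "kRm X (F X) (F Y) Y p = kRm X Y Y X p + kRm X (F Y) (F Y) X p"
    using h by (rule kRm_polarized_bianchi)
  moreover have "kRm Y (F Y) (F X) X p = kRm X (F X) (F Y) Y p"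
    using kRm_pair[OF w(2,4,3,1), of p] kRm_skew12[OF w(1,3,2,4), of p] kRm_skew34[OF w(1,3,4,2), of p]
      kRm_skew12[OF w(1,3,4,2), of p] kRm_skew34[OF w(3,1,4,2), of p] by simp
  moreover have "kRm X (F Y) (F X) Y p = kRm X (F Y) (F Y) X p"
    using kRm_F[of X "F Y" X Y p] kRm_skew34[OF w(1,4,4,1), of p] h w by simp
  moreover have "kRm Y (F X) (F Y) X p = kRm X (F Y) (F X) Y p"
    using kRm_pair[OF w(2,3,4,1), of p] kRm_skew12[OF w(1,4,3,2), of p] kRm_skew34[OF w(1,4,3,2), of p]
      kRm_skew12[OF w(4,1,2,3), of p] kRm_skew34[OF w(4,1,3,2), of p] by simp
  moreover have "kRm Y (F X) (F X) Y p = kRm X (F Y) (F Y) X p"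
    using kRm_F[of Y "F X" X Y p] kRm_F[of X "F Y" Y X p] kRm_pair[OF w(1,4,2,3), of p] h w by simp
  ultimately show ?thesis by (simp add: power2_eq_square algebra_simps)
qed

text \<open>\<open>kRm_polarized\<close> for X, Y and for X, f Y gives two linear equations in the
  same two unknowns, since f (f Y) acts as - Y and the two signs cancel.\<close>

lemma kRm_horizontal:
  assumes h: "horizontal X" "horizontal Y" and u: "G X X p = 1" "G Y Y p = 1" "G X Y p = 0"
  shows "kRm X Y Y X p = (c - s) / 4 * (1 + 3 * (G X (F Y) p)\<^sup>2)"
proof -
  note v = horizontal_VF[OF h(1)] horizontal_VF[OF h(2)]
  have "kRm X (F (F Y)) (F (F Y)) X p = kRm X Y Y X p"
    using v h kRm_pair[of "F (F Y)" X X "F (F Y)" p] kRm_pair[of X "F (F Y)" "F (F Y)" X p]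
      kRm_skew12[of X "F (F Y)" X "F (F Y)" p] kRm_skew34[of X "F (F Y)" X "F (F Y)" p]
      kRm_skew34[of X Y "F (F Y)" X p] kRm_FF4[of X "F (F Y)" X Y p] kRm_pair[of X Y X "F (F Y)" p]
      kRm_FF4[of X Y X Y p] kRm_skew34[of X Y X Y p] by simp
  then show ?thesis
    using kRm_polarized[OF h u(1,2)] kRm_polarized[OF h(1) horizontal_F[OF v(2)] u(1)] v h u
    by (simp add: horizontal_F_F field_simps)
qed

text \<open>X and Y are horizontal at \<open>p\<close> only, whereas f (f X) and f (f Y) are
  horizontal everywhere and agree with - X and - Y at \<open>p\<close>. Each replacement is made in
  the last slot, where \<open>Rm\<close> is a metric product, and the symmetries bring every
  argument there.\<close>

lemma sectional_curvature_L:
  assumes X: "VF X" and Y: "VF Y"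
    and L: "\<And>\<alpha>. \<alpha> \<in> {1..s} \<Longrightarrow> G X (\<xi> \<alpha>) p = 0" "\<And>\<alpha>. \<alpha> \<in> {1..s} \<Longrightarrow> G Y (\<xi> \<alpha>) p = 0"
    and u: "G X X p = 1" "G Y Y p = 1" "G X Y p = 0"
  shows "Rm X Y Y X p = s + (c - s) / 4 * (1 + 3 * (G X (F Y) p)\<^sup>2)"
proof -
  let ?X = "F (F X)" and ?Y = "F (F Y)"
  have GX: "G ?X Z p = - G X Z p" "G Z ?X p = - G Z X p" if "VF Z" for Z
    using X that L(1) by (auto simp: G_FF_left G_commute[of Z])
  have GY: "G ?Y Z p = - G Y Z p" "G Z ?Y p = - G Z Y p" if "VF Z" for Z
    using Y that L(2) by (auto simp: G_FF_left G_commute[of Z])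
  have "Rm X Y Y X p = - Rm X Y Y ?X p"
    using GX X Y by (simp add: Rm_eq_G)
  also have "\<dots> = Rm X Y ?X Y p" using X Y by (simp add: Rm_skew34[of X Y ?X Y])
  also have "\<dots> = - Rm X Y ?X ?Y p" using GY X Y by (simp add: Rm_eq_G)
  also have "\<dots> = - Rm ?X ?Y X Y p" using X Y by (simp add: Rm_pair[of X Y])
  also have "\<dots> = Rm ?X ?Y X ?Y p" using GY X Y by (simp add: Rm_eq_G)
  also have "\<dots> = - Rm ?X ?Y ?Y X p" using X Y by (simp add: Rm_skew34[of _ _ ?Y X])
  also have "\<dots> = Rm ?X ?Y ?Y ?X p" using GX X Y by (simp add: Rm_eq_G)
  finally have "Rm X Y Y X p = Rm ?X ?Y ?Y ?X p" .
  moreover have "G ?X (F ?Y) p = G X (F Y) p"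
    using GX[of "F ?Y"] G_F_right[of X ?Y p] GY[of "F X"] G_F_right[of X Y p] X Y by simp
  moreover have "G ?X ?X p = 1" "G ?Y ?Y p = 1" "G ?X ?Y p = 0" "G ?Y ?X p = 0"
    using GX GY X Y u G_commute[OF X Y, of p] by simp_all
  ultimately show ?thesis
    using kRm_horizontal[of ?X ?Y p] X Y by (simp add: kRm_def)
qed

lemma constant_L_iff:
  assumes "2 \<le> n"
  shows "constant_L_sectional_curvature s A \<xi> g D c \<longleftrightarrow> c = real s"
proof
  assume L: "constant_L_sectional_curvature s A \<xi> g D c"
  \<comment> \<open>Any point will do; the manifold is a type and so nonempty.\<close>
  fix p
  obtain X Y where XY: "horizontal X" "horizontal Y" "G X X p = 1" "G Y Y p = 1"
    "G X Y p = 0" "G X (F Y) p = 0"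
    using exists_orthonormal_F_orthogonal[OF assms] by blast
  then have "X p \<in> L_space s A \<xi> g p" "Y p \<in> L_space s A \<xi> g p"
    by (simp_all add: L_space_def horizontal_def G_def)
  then have "Rm X Y Y X p = c"
    using L XY unfolding constant_L_sectional_curvature_def Rm_def sectional_curvature_def
    by (simp add: G_def)
  \<comment> \<open>The curvature formula now reads c = s + (c - s)/4.\<close>
  then show "c = real s"
    using sectional_curvature_L[of X Y p] XY by (simp add: horizontal_G_xi field_simps)
next
  assume "c = real s"
  then show "constant_L_sectional_curvature s A \<xi> g D c"
    using sectional_curvature_L
    unfolding constant_L_sectional_curvature_def L_space_def sectional_curvature_def Rm_def G_def
    by simp
qed

end

text \<open>The bound on \<open>n\<close> matters: for n = 1 orthonormal horizontal X, Y satisfy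
  g(X, f Y)^2 = 1, and the formula of \<open>sectional_curvature_L\<close> returns c for every
  c.\<close>

theorem corollary3p2:
  fixes A :: "('m::{t2_space,second_countable_topology}, 'e::euclidean_space) atlas"
    and f :: "'m \<Rightarrow> 'm tvec \<Rightarrow> 'm tvec"
    and \<xi> :: "nat \<Rightarrow> 'm vfield"
    and \<eta> :: "nat \<Rightarrow> 'm \<Rightarrow> 'm tvec \<Rightarrow> real"
    and g :: "'m \<Rightarrow> 'm tvec \<Rightarrow> 'm tvec \<Rightarrow> real"
    and D :: "'m vfield \<Rightarrow> 'm vfield \<Rightarrow> 'm vfield"
    and n s :: nat and c :: real
  assumes "S_space_form n s A f \<xi> \<eta> g D c"
    and "2 \<le> n"
  shows "constant_L_sectional_curvature s A \<xi> g D c \<longleftrightarrow> c = real s"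
proof -
  interpret s_space_form A f \<xi> \<eta> g D n s c
    using assms(1) unfolding S_space_form_def by unfold_locales auto
  show ?thesis by (rule constant_L_iff[OF assms(2)])
qed

end
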